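(* Let $p$ be an odd prime and $(K,|\cdot|)$ an algebraically closed ultrametric field of residue characteristic $p$. Let $\lambda\in K$ with $|\lambda|=1$ such that the order $q$ of $\widetilde\lambda$ in $\widetilde K^*$ is finite and $\lambda^q\ne1$; if $K$ has characteristic zero assume moreover that $\lambda$ is transcendental over the prime field of $K$. Let $P_\lambda(z)=\lambda z+z^2$. Then: (1) if the reduction of $P_\lambda$ is minimally ramified, then for each integer $n\ge1$ the polynomial $P_\lambda$ has a unique cycle of minimal period $qp^n$, and this cycle is an optimal cycle of period $qp^n$; (2) if the reduction of $P_\lambda$ is not minimally ramified, then there is no integer $n\ge1$ for which $P_\lambda$ has an optimal cycle of period $qp^n$.
   Context: $\mathcal{O}_K=\{|z|\le1\}$, $\mathfrak{m}_K=\{|z|<1\}$, $\widetilde K=\mathcal{O}_K/\mathfrak{m}_K$; reductions are coefficientwise. Periodic points are considered in $\mathfrak{m}_K$. For $f(z)=\lambda z+\cdots\in\mathcal{O}_K[[z]]$ with $|\lambda|=1$, $\widetilde\lambda$ of order $q$, and $n\ge1$ with $\lambda^{qp^n}\ne1$, $f$ has an optimal cycle of period $qp^n$ if it has a periodic point $z_0$ of minimal period $qp^n$ with $|z_0|=\left|\frac{\lambda^{qp^n}-1}{\lambda^{qp^{n-1}}-1}\right|^{1/(qp^n)}$. For a field $k$ of characteristic $p$, $\mathrm{ord}$ is the lowest degree of a nonzero term in $k[[\zeta]]$; for $h(\zeta)=\zeta+\cdots$, $i_n(h)=\mathrm{ord}\big((h^{p^n}(\zeta)-\zeta)/\zeta\big)$.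 For a root of unity $\gamma\in k$ of order $q$, $g(\zeta)=\gamma\zeta+\cdots$ is minimally ramified if $i_n(g^q)=q\frac{p^{n+1}-1}{p-1}$ for all $n\ge0$. *)

theory Defs
  imports "HOL-Computational_Algebra.Polynomial"
begin

definition ultrametric_abs :: "('a::field \<Rightarrow> real) \<Rightarrow> bool" where
  "ultrametric_abs av \<longleftrightarrow>
     (\<forall>x. 0 \<le> av x) \<and> (\<forall>x. av x = 0 \<longleftrightarrow> x = 0) \<and>
     (\<forall>x y. av (x * y) = av x * av y) \<and>
     (\<forall>x y. av (x + y) \<le> max (av x) (av y))"

definition alg_closed_field :: "'a::field itself \<Rightarrow> bool" where
  "alg_closed_field _ \<longleftrightarrow> (\<forall>P :: 'a poly. 1 \<le> degree P \<longrightarrow> (\<exists>x. poly P x = 0))"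

text \<open>Residue characteristic p: p lies in the maximal ideal (p prime).\<close>
definition residue_char :: "('a::field \<Rightarrow> real) \<Rightarrow> nat \<Rightarrow> bool" where
  "residue_char av p \<longleftrightarrow> av (of_nat p) < 1"

definition residue_order :: "('a::field \<Rightarrow> real) \<Rightarrow> 'a \<Rightarrow> nat \<Rightarrow> bool" where
  "residue_order av lam q \<longleftrightarrow> 0 < q \<and> av (lam ^ q - 1) < 1 \<and>
     (\<forall>k. 0 < k \<and> k < q \<longrightarrow> \<not> av (lam ^ k - 1) < 1)"

definition min_period :: "('a \<Rightarrow> 'a) \<Rightarrow> 'a \<Rightarrow> nat \<Rightarrow> bool" where
  "min_period f z m \<longleftrightarrow> 0 < m \<and> (f ^^ m) z = z \<and> (\<forall>k. 0 < k \<and> k < m \<longrightarrow> (f ^^ k) z \<noteq> z)"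

definition orbit :: "('a \<Rightarrow> 'a) \<Rightarrow> 'a \<Rightarrow> 'a set" where
  "orbit f z = range (\<lambda>k. (f ^^ k) z)"

definition quad_map :: "'a::comm_ring_1 \<Rightarrow> 'a \<Rightarrow> 'a" where
  "quad_map lam z = lam * z + z ^ 2"

definition quad_poly :: "'a::comm_ring_1 \<Rightarrow> 'a poly" where
  "quad_poly lam = [:0, lam, 1:]"

definition poly_iter :: "'a::comm_ring_1 poly \<Rightarrow> nat \<Rightarrow> 'a poly" where
  "poly_iter P m = ((\<lambda>g. pcompose P g) ^^ m) [:0, 1:]"

text \<open>Order (lowest degree of a nonzero term) of the reduction of (h(zeta) - zeta)/zeta,
  for h with coefficients in O_K: the reduction of a coefficient c is nonzero iff |c| >= 1.
  Returns None when the reduction is zero (order infinity).\<close>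
definition red_ord_shift :: "('a::comm_ring_1 \<Rightarrow> real) \<Rightarrow> 'a poly \<Rightarrow> nat option" where
  "red_ord_shift av h =
     (if \<exists>j. 1 \<le> av (coeff (h - [:0, 1:]) (Suc j))
      then Some (LEAST j. 1 \<le> av (coeff (h - [:0, 1:]) (Suc j))) else None)"

definition red_i :: "('a::comm_ring_1 \<Rightarrow> real) \<Rightarrow> nat \<Rightarrow> 'a poly \<Rightarrow> nat \<Rightarrow> nat option" where
  "red_i av p h n = red_ord_shift av (poly_iter h (p ^ n))"

text \<open>The reduction g of P (with reduced linear coefficient of order q) is minimally ramified:
  i_n(g^q) = q (p^{n+1}-1)/(p-1) for all n >= 0.  Note the reduction of the q-th iterate
  of P equals the q-th iterate of the reduction.\<close>
definition red_minimally_ramified ::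
  "('a::comm_ring_1 \<Rightarrow> real) \<Rightarrow> nat \<Rightarrow> nat \<Rightarrow> 'a poly \<Rightarrow> bool" where
  "red_minimally_ramified av p q P \<longleftrightarrow>
     (\<forall>n. red_i av p (poly_iter P q) n = Some (q * ((p ^ (n + 1) - 1) div (p - 1))))"

definition optimal_cycle_point ::
  "('a::field \<Rightarrow> real) \<Rightarrow> 'a \<Rightarrow> ('a \<Rightarrow> 'a) \<Rightarrow> nat \<Rightarrow> nat \<Rightarrow> nat \<Rightarrow> 'a \<Rightarrow> bool" where
  "optimal_cycle_point av lam f p q n z \<longleftrightarrow>
     lam ^ (q * p ^ n) \<noteq> 1 \<and> av z < 1 \<and> min_period f z (q * p ^ n) \<and>
     av z = av ((lam ^ (q * p ^ n) - 1) / (lam ^ (q * p ^ (n - 1)) - 1))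
              powr (1 / real (q * p ^ n))"

definition has_optimal_cycle ::
  "('a::field \<Rightarrow> real) \<Rightarrow> 'a \<Rightarrow> ('a \<Rightarrow> 'a) \<Rightarrow> nat \<Rightarrow> nat \<Rightarrow> nat \<Rightarrow> bool" where
  "has_optimal_cycle av lam f p q n \<longleftrightarrow> (\<exists>z. optimal_cycle_point av lam f p q n z)"

end

(* The fixed points of the iterates of P in the open unit disc are counted, with multiplicity, by the
   order of the reduction of P^m - id. A quadratic polynomial with transcendental lam has only simple periodic points:
   at the place lam = infinity its nonzero cycles are all repelling, and a Nakayama argument over
   Z[1/lam] turns this into a proof. So the points of minimal period q p^n number i_n - i_(n-1), they fall
   into cycles of q p^n points of equal absolute value, and the product of their absolute values is
   |(lam^(q p^n) - 1) / (lam^(q p^(n-1)) - 1)| < 1. Hence there is an optimal cycle of period q p^n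
   iff i_n - i_(n-1) = q p^n, iff the cycle is unique.

   It remains to see that equality for one n >= 1 forces minimal ramification. Equality together with
   i_n >= p i_(n-1) and q | i_(n-1) gives i_0 = q and i_1 = q (p + 1). Semiconjugating the reduction of P
   by some y = X^q + ... to a series G tangent to the identity divides all i_n by q, so let q = 1 and
   write h = X + a X^2 + b X^3 + ... with i_1 = p + 1, that is b <> a^2. For h^(p^n) =
   X + A X^(I+1) + B X^(I+2) + ..., commutation with h gives a B = A (b - a^2), so B <> 0, and
   p-th finite differences show that B <> 0 forces i_(n+1) = p I + 1. *)

theory Submission
  imports Defs "HOL-Computational_Algebra.Computational_Algebra" "HOL-Number_Theory.Cong" "HOL-Library.FuncSet"
begin

section \<open>Simplicity of the periodic points of a generic quadratic polynomial\<close>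

text \<open>Put t = 1/lam and w_i = t z_i along a cycle. Then w_i^2 + w_i = t w_(i+1), so (1 + 2
  w_i)^2 = 1 + 4 t w_(i+1). A multiplier equal to 1 would make the product of these squares t^(2m),
  although it is 1 modulo t. To avoid extending a place to K, this is expressed with a finitely
  generated module over Z[t]. The only way out is 0 in 1 + t Z[t], that is, lam integral over the
  image of Z; in characteristic 0 this contradicts transcendence, in characteristic p it makes lam a
  root of unity. The residue field is never formed: congruences between reductions are memberships
  in \<open>red_ideal M\<close>, and series are replaced by polynomials. The pair y, G
  semiconjugates only up to a prescribed degree, so this degree is chosen after the finitely many
  indices to be compared. In the p-th difference only the exponents modulo p matter, and I = 1
  modulo p at every level, so one computation serves all levels. Only I = 1 differs: there the term
  quadratic in A reaches second order, which is why the first level asks for b <> a^2 and the later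
  ones for B <> 0.\<close>

definition int_adjoin :: "'a::comm_ring_1 \<Rightarrow> 'a set" where
  "int_adjoin t = range (\<lambda>P. poly (map_poly of_int P) t)"

lemma map_poly_of_int_add: "map_poly of_int (P + Q) = (map_poly of_int P + map_poly of_int Q :: 'a::comm_ring_1 poly)"
  by (rule poly_eqI) (simp add: coeff_map_poly)

lemma map_poly_of_int_minus: "map_poly of_int (- P) = (- map_poly of_int P :: 'a::comm_ring_1 poly)"
  by (rule poly_eqI) (simp add: coeff_map_poly)

lemma map_poly_of_int_mult: "map_poly of_int (P * Q) = (map_poly of_int P * map_poly of_int Q :: 'a::comm_ring_1 poly)"
  by (rule poly_eqI) (simp add: coeff_map_poly coeff_mult)

lemma int_adjoin_of_int: "of_int n \<in> int_adjoin t"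
  unfolding int_adjoin_def by (rule range_eqI[of _ _ "[:n:]"]) (simp add: map_poly_pCons)

lemma int_adjoin_0 [simp]: "0 \<in> int_adjoin t" and int_adjoin_1 [simp]: "1 \<in> int_adjoin t"
  using int_adjoin_of_int[of 0 t] int_adjoin_of_int[of 1 t] by simp_all

lemma int_adjoin_self: "t \<in> int_adjoin t"
  unfolding int_adjoin_def by (rule range_eqI[of _ _ "[:0, 1:]"]) (simp add: map_poly_pCons)

lemma int_adjoin_add: "x \<in> int_adjoin t \<Longrightarrow> y \<in> int_adjoin t \<Longrightarrow> x + y \<in> int_adjoin t"
  unfolding int_adjoin_def by (auto simp flip: poly_add map_poly_of_int_add)

lemma int_adjoin_minus: "x \<in> int_adjoin t \<Longrightarrow> - x \<in> int_adjoin t"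
  unfolding int_adjoin_def by (auto simp flip: poly_minus map_poly_of_int_minus)

lemma int_adjoin_mult: "x \<in> int_adjoin t \<Longrightarrow> y \<in> int_adjoin t \<Longrightarrow> x * y \<in> int_adjoin t"
  unfolding int_adjoin_def by (auto simp flip: poly_mult map_poly_of_int_mult)

section \<open>Spans over Z[t] and the multiplicative set 1 + t Z[t]\<close>

definition int_adjoin_span :: "'a::comm_ring_1 \<Rightarrow> 'a set \<Rightarrow> 'a set" where
  "int_adjoin_span t V = {\<Sum>v\<in>V. c v * v | c. \<forall>v\<in>V. c v \<in> int_adjoin t}"

lemma int_adjoin_spanI:
  "(\<And>v. v \<in> V \<Longrightarrow> c v \<in> int_adjoin t) \<Longrightarrow> (\<Sum>v\<in>V. c v * v) \<in> int_adjoin_span t V"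
  by (auto simp: int_adjoin_span_def)

lemma int_adjoin_span_superset:
  assumes "finite V" "v \<in> V"
  shows "v \<in> int_adjoin_span t V"
proof -
  have "v = (\<Sum>w\<in>V. (if w = v then 1 else 0) * w)"
    using assms by (simp add: sum.delta if_distrib[of "\<lambda>x. x * _"] cong: if_cong)
  also have "\<dots> \<in> int_adjoin_span t V"
    by (rule int_adjoin_spanI) auto
  finally show ?thesis .
qed

lemma int_adjoin_span_0: "0 \<in> int_adjoin_span t V"
  using int_adjoin_spanI[of V "\<lambda>_. 0" t] by simp

lemma int_adjoin_span_add:
  assumes "x \<in> int_adjoin_span t V" "y \<in> int_adjoin_span t V"
  shows "x + y \<in> int_adjoin_span t V"
proof -
  obtain c d where "x = (\<Sum>v\<in>V. c v * v)" "\<forall>v\<in>V. c v \<in> int_adjoin t"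
    "y = (\<Sum>v\<in>V. d v * v)" "\<forall>v\<in>V. d v \<in> int_adjoin t"
    using assms by (auto simp: int_adjoin_span_def)
  thus ?thesis
    using int_adjoin_spanI[of V "\<lambda>v. c v + d v" t] by (simp add: int_adjoin_add algebra_simps sum.distrib)
qed

lemma int_adjoin_span_mult:
  assumes "a \<in> int_adjoin t" "x \<in> int_adjoin_span t V"
  shows "a * x \<in> int_adjoin_span t V"
proof -
  obtain c where "x = (\<Sum>v\<in>V. c v * v)" "\<forall>v\<in>V. c v \<in> int_adjoin t"
    using assms by (auto simp: int_adjoin_span_def)
  thus ?thesis
    using assms int_adjoin_spanI[of V "\<lambda>v. a * c v" t] by (simp add: int_adjoin_mult sum_distrib_left mult.assoc)
qed

lemma int_adjoin_span_minus: "x \<in> int_adjoin_span t V \<Longrightarrow> - x \<in> int_adjoin_span t V"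
  using int_adjoin_span_mult[OF int_adjoin_minus[OF int_adjoin_1], of x t V] by simp

lemma int_adjoin_span_sum:
  "(\<And>i. i \<in> I \<Longrightarrow> f i \<in> int_adjoin_span t V) \<Longrightarrow> sum f I \<in> int_adjoin_span t V"
  by (induction I rule: infinite_finite_induct) (auto intro: int_adjoin_span_0 int_adjoin_span_add)

lemma int_adjoin_span_insert:
  assumes "finite V" "x \<notin> V" "y \<in> int_adjoin_span t (insert x V)"
  obtains a s where "a \<in> int_adjoin t" "s \<in> int_adjoin_span t V" "y = a * x + s"
proof -
  obtain c where "y = (\<Sum>v\<in>insert x V. c v * v)" "\<forall>v\<in>insert x V. c v \<in> int_adjoin t"
    using assms by (auto simp: int_adjoin_span_def)
  thus ?thesis
    using that[of "c x" "\<Sum>v\<in>V. c v * v"] assms int_adjoin_spanI[of V c t] by simp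
qed

text \<open>Inverting this multiplicative set would put t into the Jacobson radical. For t = 1/lam
  it contains 0 exactly if lam is integral over the image of Z.\<close>

definition one_plus_ideal :: "'a::comm_ring_1 \<Rightarrow> 'a set" where
  "one_plus_ideal t = {1 + t * a | a. a \<in> int_adjoin t}"

lemma one_plus_idealI: "a \<in> int_adjoin t \<Longrightarrow> 1 + t * a \<in> one_plus_ideal t"
  by (auto simp: one_plus_ideal_def)

lemma one_plus_ideal_mult: "u \<in> one_plus_ideal t \<Longrightarrow> v \<in> one_plus_ideal t \<Longrightarrow> u * v \<in> one_plus_ideal t"
proof -
  assume "u \<in> one_plus_ideal t" "v \<in> one_plus_ideal t"
  then obtain a b where "u = 1 + t * a" "v = 1 + t * b" "a \<in> int_adjoin t" "b \<in> int_adjoin t"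
    by (auto simp: one_plus_ideal_def)
  hence "u * v = 1 + t * (a + b + t * (a * b))" "a + b + t * (a * b) \<in> int_adjoin t"
    by (auto simp: algebra_simps intro!: int_adjoin_add int_adjoin_mult int_adjoin_self)
  thus ?thesis
    using one_plus_idealI by metis
qed

lemma one_plus_ideal_subset: "u \<in> one_plus_ideal t \<Longrightarrow> u \<in> int_adjoin t"
  by (auto simp: one_plus_ideal_def intro!: int_adjoin_add int_adjoin_mult int_adjoin_self)

text \<open>Nakayama's lemma for the ideal \<open>t A\<close> of \<open>A = \<int>[t]\<close>, with multipliers in \<open>1 + t A\<close> instead of a localisation.\<close>

lemma nakayama:
  assumes "finite V"
    and "\<And>v. v \<in> V \<Longrightarrow> \<exists>u\<in>one_plus_ideal t. \<exists>s\<in>int_adjoin_span t V. u * v = t * s"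
  shows "\<exists>u\<in>one_plus_ideal t. \<forall>v\<in>V. u * v = 0"
  using assms
proof (induction V rule: finite_induct)
  case empty
  have "1 + t * 0 \<in> one_plus_ideal t"
    by (rule one_plus_idealI) simp
  thus ?case
    by auto
next
  case (insert x V)
  obtain ux sx where ux: "ux \<in> one_plus_ideal t" "sx \<in> int_adjoin_span t (insert x V)" "ux * x = t * sx"
    using insert.prems by blast
  obtain a s where as: "a \<in> int_adjoin t" "s \<in> int_adjoin_span t V" "sx = a * x + s"
    using int_adjoin_span_insert[OF insert.hyps ux(2)] .
  obtain ux' where ux': "ux' \<in> int_adjoin t" "ux = 1 + t * ux'"
    using ux(1) by (auto simp: one_plus_ideal_def)
  \<comment> \<open>Moving the \<open>x\<close>-part of \<open>sx\<close> to the left gives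
    \<open>U * x = t * s\<close> with \<open>s\<close> in the span of the other generators;
    \<open>U\<close> is still 1 modulo t.\<close>
  define U where "U = ux - t * a"
  have "ux' - a \<in> int_adjoin t"
    using int_adjoin_add[OF ux'(1) int_adjoin_minus[OF as(1)]] by simp
  hence U: "U \<in> one_plus_ideal t"
    using one_plus_idealI[of "ux' - a" t] by (simp add: U_def ux' algebra_simps)
  have Ux: "U * x = t * s"
    using ux(3) as(3) by (simp add: U_def algebra_simps)
  have "\<exists>u\<in>one_plus_ideal t. \<exists>s\<in>int_adjoin_span t V. u * v = t * s" if v: "v \<in> V" for v
  proof -
    obtain uv sv where uv: "uv \<in> one_plus_ideal t" "sv \<in> int_adjoin_span t (insert x V)" "uv * v = t * sv"
      using insert.prems v by blast
    obtain b r where br: "b \<in> int_adjoin t" "r \<in> int_adjoin_span t V" "sv = b * x + r"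
      using int_adjoin_span_insert[OF insert.hyps uv(2)] .
    \<comment> \<open>Multiplying by \<open>U\<close> turns the \<open>x\<close>-part of
      \<open>sv\<close> into a multiple of \<open>U * x\<close>, which lies in the smaller
      span.\<close>
    have "U * uv * v = t * (b * (U * x) + U * r)"
      using uv(3) br(3) by (simp add: algebra_simps)
    also have "\<dots> = t * ((b * t) * s + U * r)"
      by (simp add: Ux algebra_simps)
    finally have "U * uv * v = t * ((b * t) * s + U * r)" .
    moreover have "(b * t) * s + U * r \<in> int_adjoin_span t V"
      using br as one_plus_ideal_subset[OF U]
      by (intro int_adjoin_span_add int_adjoin_span_mult int_adjoin_mult int_adjoin_self)
    ultimately show ?thesis
      using one_plus_ideal_mult[OF U uv(1)] by blast
  qed
  then obtain u where u: "u \<in> one_plus_ideal t" "\<forall>v\<in>V. u * v = 0"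
    using insert.IH by blast
  obtain c where "s = (\<Sum>v\<in>V. c v * v)"
    using as(2) by (auto simp: int_adjoin_span_def)
  hence "u * s = (\<Sum>v\<in>V. c v * (u * v))"
    by (simp add: sum_distrib_left algebra_simps)
  hence "u * s = 0"
    using u(2) by simp
  have "u * U * x = t * (u * s)"
    by (metis Ux mult.assoc mult.left_commute)
  hence "u * U * x = 0"
    using \<open>u * s = 0\<close> by simp
  moreover have "u * U * v = 0" if "v \<in> V" for v
    using u(2) that by (metis mult.assoc mult.commute mult_zero_left)
  ultimately show ?case
    using one_plus_ideal_mult[OF u(1) U] by blast
qed

text \<open>With \<open>w i ^ 2 = t * w (i + 1) - w i\<close> for all \<open>i\<close> modulo \<open>m\<close>, the squarefree monomials span
  \<open>\<int>[t, w 0, \<dots>, w (m - 1)]\<close> over \<open>\<int>[t]\<close>.\<close>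

lemma zero_in_one_plus_ideal_if_prod:
  fixes w :: "nat \<Rightarrow> 'a::comm_ring_1"
  assumes w: "\<And>i. i < m \<Longrightarrow> w i ^ 2 = t * w (s i) - w i" "\<And>i. i < m \<Longrightarrow> s i < m"
    and prod: "(\<Prod>i<m. 1 + t * (4 * w i)) = t ^ Suc k"
  shows "0 \<in> one_plus_ideal t"
proof -
  define mon where "mon = (\<lambda>S. \<Prod>i\<in>S. w i)"
  define V where "V = mon ` Pow {..<m}"
  have V: "finite V"
    by (simp add: V_def)
  have mon_V: "mon S \<in> int_adjoin_span t V" if "S \<subseteq> {..<m}" for S
    using that V by (intro int_adjoin_span_superset) (auto simp: V_def)
  have w_mon: "w i * mon S \<in> int_adjoin_span t V" if "i < m" "S \<subseteq> {..<m}" for i S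
    using that
  \<comment> \<open>Only a repeated factor \<open>w i\<close> needs the quadratic relation, and the
    product it leaves, \<open>w (s i) * mon (S - {i})\<close>, involves a smaller set.\<close>
  proof (induction "card S" arbitrary: i S rule: less_induct)
    case less
    have fin: "finite S"
      using less.prems finite_subset by blast
    show ?case
    proof (cases "i \<in> S")
      case False
      hence "w i * mon S = mon (insert i S)"
        using fin by (simp add: mon_def)
      thus ?thesis
        using less.prems by (auto intro!: mon_V)
    next
      case True
      hence mon_S: "mon S = w i * mon (S - {i})"
        using fin by (simp add: mon_def prod.remove)
      hence "w i * mon S = w i ^ 2 * mon (S - {i})"
        by (simp add: power2_eq_square mult.assoc)
      also have "\<dots> = t * (w (s i) * mon (S - {i})) + - mon S"
        unfolding w(1)[OF less.prems(1)] mon_S by (simp add: algebra_simps)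
      also have "\<dots> \<in> int_adjoin_span t V"
      proof (rule int_adjoin_span_add[OF int_adjoin_span_mult[OF int_adjoin_self] int_adjoin_span_minus])
        show "w (s i) * mon (S - {i}) \<in> int_adjoin_span t V"
          using True fin less.prems w(2) by (intro less.hyps card_Diff1_less) auto
        show "mon S \<in> int_adjoin_span t V"
          using less.prems by (intro mon_V)
      qed
      finally show ?thesis .
    qed
  qed
  have w_span: "w i * x \<in> int_adjoin_span t V" if "i < m" "x \<in> int_adjoin_span t V" for i x
  proof -
    obtain c where c: "x = (\<Sum>v\<in>V. c v * v)" "\<forall>v\<in>V. c v \<in> int_adjoin t"
      using \<open>x \<in> _\<close> by (auto simp: int_adjoin_span_def)
    have "w i * x = (\<Sum>v\<in>V. c v * (w i * v))"
      by (simp add: c(1) sum_distrib_left algebra_simps)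
    also have "\<dots> \<in> int_adjoin_span t V"
    proof (rule int_adjoin_span_sum)
      fix v assume "v \<in> V"
      thus "c v * (w i * v) \<in> int_adjoin_span t V"
        using c(2) w_mon[OF that(1)] by (intro int_adjoin_span_mult[of "c v"]) (auto simp: V_def)
    qed
    finally show ?thesis .
  qed
  have mon_span: "mon S * x \<in> int_adjoin_span t V" if "finite S" "S \<subseteq> {..<m}" "x \<in> int_adjoin_span t V" for S x
    using that by (induction S rule: finite_induct) (auto simp: mon_def mult.assoc intro: w_span)
  have one: "1 \<in> int_adjoin_span t V"
    using mon_V[of "{}"] by (simp add: mon_def)

  \<comment> \<open>The product is 1 modulo t times the span, and by assumption it is also a
    positive power of t. So 1 lies in t times the span, and hence so does every generator.\<close>
  have "\<exists>r\<in>int_adjoin_span t V. (\<Prod>i<n. 1 + t * (4 * w i)) = 1 + t * r" if "n \<le> m" for n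
    using that
  proof (induction n)
    case 0
    show ?case
      using int_adjoin_span_0 by (intro bexI[of _ 0]) auto
  next
    case (Suc n)
    then obtain r where r: "r \<in> int_adjoin_span t V" "(\<Prod>i<n. 1 + t * (4 * w i)) = 1 + t * r"
      by auto
    have "(\<Prod>i<Suc n. 1 + t * (4 * w i)) = 1 + t * (r + 4 * (w n * 1) + (4 * t) * (w n * r))"
      using r(2) by (simp add: algebra_simps)
    moreover have "4 \<in> int_adjoin t"
      using int_adjoin_of_int[of 4 t] by simp
    hence "r + 4 * (w n * 1) + (4 * t) * (w n * r) \<in> int_adjoin_span t V"
      using Suc.prems r(1) one
      by (intro int_adjoin_span_add int_adjoin_span_mult int_adjoin_mult int_adjoin_self w_span) auto
    ultimately show ?case
      by blast
  qed
  then obtain r where r: "r \<in> int_adjoin_span t V" "(\<Prod>i<m. 1 + t * (4 * w i)) = 1 + t * r"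
    by blast
  have r: "r \<in> int_adjoin_span t V" "t ^ Suc k = 1 + t * r"
    using r prod by simp_all
  have "t ^ n \<in> int_adjoin t" for n
    by (induction n) (auto intro: int_adjoin_mult int_adjoin_self)
  hence "t ^ k * 1 + - r \<in> int_adjoin_span t V"
    by (intro int_adjoin_span_add int_adjoin_span_minus int_adjoin_span_mult one r)
  moreover have one_eq: "1 = t * (t ^ k * 1 + - r)"
    using r(2) by (simp add: algebra_simps)
  ultimately have "\<exists>u\<in>one_plus_ideal t. \<exists>s\<in>int_adjoin_span t V. u * v = t * s" if v: "v \<in> V" for v
  proof -
    obtain S where S: "v = mon S" "S \<subseteq> {..<m}"
      using v by (auto simp: V_def)
    have "1 + t * 0 \<in> one_plus_ideal t"
      by (rule one_plus_idealI) simp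
    moreover have "mon S * (t ^ k * 1 + - r) \<in> int_adjoin_span t V"
      using S \<open>t ^ k * 1 + - r \<in> _\<close> finite_subset by (intro mon_span) auto
    moreover have "(1 + t * 0) * v = t * (mon S * (t ^ k * 1 + - r))"
      using one_eq S(1) by (metis add.right_neutral mult.left_commute mult.right_neutral mult_1 mult_zero_right)
    ultimately show ?thesis
      by blast
  qed
  then obtain u where u: "u \<in> one_plus_ideal t" "\<forall>v\<in>V. u * v = 0"
    using nakayama[OF V] by blast
  \<comment> \<open>The empty monomial is a generator, so a multiplier killing all generators is
    0.\<close>
  have "1 \<in> V"
    by (auto simp: V_def mon_def intro!: image_eqI[of _ _ "{}"])
  hence "u = 0"
    using u(2) by (metis mult.right_neutral)
  thus ?thesis
    using u(1) by simp
qed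

text \<open>The product is the multiplier of \<open>z\<close> under the m-th iterate, so a value
  other than 1 makes \<open>z\<close> a simple root of the iterate minus the identity. The case
  \<open>z = 0\<close> shows that lam is not a root of unity.\<close>

lemma quad_map_funpow_fixed_simple:
  fixes lam :: "'a::field"
  assumes lam: "lam \<noteq> 0" and t: "0 \<notin> one_plus_ideal (inverse lam)"
    and m: "0 < m" and fixed: "(quad_map lam ^^ m) z = z"
  shows "(\<Prod>i<m. lam + 2 * (quad_map lam ^^ i) z) \<noteq> 1"
proof
  assume mult: "(\<Prod>i<m. lam + 2 * (quad_map lam ^^ i) z) = 1"
  define t where "t = inverse lam"
  define w where "w = (\<lambda>i. t * (quad_map lam ^^ i) z)"
  define s where "s = (\<lambda>i. Suc i mod m)"
  have tl: "t * lam = 1"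
    using lam by (simp add: t_def)
  have w_Suc: "w (Suc i) = w (s i)" if "i < m" for i
  proof (cases "Suc i = m")
    case True
    thus ?thesis
      using fixed by (auto simp: w_def s_def)
  qed (use that in \<open>auto simp: s_def\<close>)
  have step: "w i ^ 2 = t * w (Suc i) - w i" for i
  proof -
    have "t * w (Suc i) = t * (t * lam) * (quad_map lam ^^ i) z + w i ^ 2"
      by (simp add: w_def quad_map_def algebra_simps power2_eq_square)
    thus ?thesis
      by (simp add: tl w_def)
  qed
  have "(\<Prod>i<m. 1 + 2 * w i) = (\<Prod>i<m. t * (lam + 2 * (quad_map lam ^^ i) z))"
    by (intro prod.cong) (simp_all add: w_def distrib_left tl mult.left_commute)
  also have "\<dots> = t ^ m"
    by (simp only: prod.distrib mult) simp
  finally have prod: "(\<Prod>i<m. 1 + 2 * w i) = t ^ m" .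
  \<comment> \<open>The squares naturally produce \<open>w (s i)\<close>; as \<open>s\<close>
    permutes the indices cyclically, the product may be shifted.\<close>
  have "(\<Prod>i<m. 1 + t * (4 * w i)) = (\<Prod>i<m. 1 + t * (4 * w (s i)))"
  proof -
    have "bij_betw s {..<m} {..<m}"
    proof (rule bij_betw_imageI)
      show inj: "inj_on s {..<m}"
        by (auto simp: inj_on_def s_def mod_Suc split: if_splits)
      show "s ` {..<m} = {..<m}"
        using inj m by (intro endo_inj_surj) (auto simp: s_def)
    qed
    thus ?thesis
      using prod.reindex_bij_betw[of s "{..<m}" "{..<m}" "\<lambda>i. 1 + t * (4 * w i)"] by simp
  qed
  also have "\<dots> = (\<Prod>i<m. (1 + 2 * w i) ^ 2)"
  proof (intro prod.cong refl)
    fix i assume "i \<in> {..<m}"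
    hence "t * w (s i) = w i ^ 2 + w i"
      using step[of i] w_Suc[of i] by simp
    hence "1 + 4 * (t * w (s i)) = (1 + 2 * w i) ^ 2"
      by (simp add: power2_eq_square algebra_simps)
    thus "1 + t * (4 * w (s i)) = (1 + 2 * w i) ^ 2"
      by (simp add: mult.left_commute)
  qed
  also have "\<dots> = t ^ (2 * m)"
    by (simp only: prod_power_distrib [symmetric] prod) (simp add: mult.commute flip: power_mult)
  also have "2 * m = Suc (2 * m - 1)"
    using m by simp
  finally have "0 \<in> one_plus_ideal t"
    using step w_Suc m by (intro zero_in_one_plus_ideal_if_prod[of m w t s "2 * m - 1"]) (auto simp: s_def)
  thus False
    using t by (simp add: t_def)
qed

text \<open>Multiply 1 + t P(t) = 0 by lam^(n + 1), where t = 1/lam.\<close>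

lemma zero_in_one_plus_ideal_imp_integral:
  fixes lam :: "'a::field"
  assumes "lam \<noteq> 0" "0 \<in> one_plus_ideal (inverse lam)"
  obtains n c where "lam ^ Suc n = (\<Sum>i\<le>n. of_int (c i) * lam ^ i)"
proof -
  obtain P where P: "0 = 1 + inverse lam * poly (map_poly of_int P) (inverse lam)"
    using assms(2) by (auto simp: one_plus_ideal_def int_adjoin_def)
  \<comment> \<open>The degree is taken after mapping to the field, where leading coefficients of
    \<open>P\<close> may vanish.\<close>
  define n where "n = degree (map_poly of_int P :: 'a poly)"
  have "inverse lam * poly (map_poly of_int P) (inverse lam) = - 1"
    using P by (simp add: eq_neg_iff_add_eq_0 add.commute)
  hence "lam ^ Suc n = lam ^ Suc n * (- (inverse lam * poly (map_poly of_int P) (inverse lam)))"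
    by (simp only:) simp
  also have "\<dots> = - (lam ^ n * poly (map_poly of_int P) (inverse lam))"
    using assms(1) by (simp add: field_simps)
  also have "\<dots> = (\<Sum>i\<le>n. - (lam ^ n * (of_int (coeff P i) * inverse lam ^ i)))"
    by (simp add: poly_altdef n_def coeff_map_poly sum_distrib_left sum_negf)
  also have "\<dots> = (\<Sum>i\<le>n. of_int (- coeff P i) * lam ^ (n - i))"
  proof (intro sum.cong refl)
    fix i assume "i \<in> {..n}"
    hence "lam ^ n = lam ^ (n - i) * lam ^ i"
      by (simp flip: power_add)
    thus "- (lam ^ n * (of_int (coeff P i) * inverse lam ^ i)) = of_int (- coeff P i) * lam ^ (n - i)"
      using assms(1) by (simp add: power_inverse)
  qed
  also have "\<dots> = (\<Sum>i\<le>n. of_int (- coeff P (n - i)) * lam ^ i)"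
    by (rule sum.reindex_bij_witness[of _ "\<lambda>i. n - i" "\<lambda>i. n - i"]) auto
  finally show ?thesis
    by (rule that)
qed

lemma zero_not_in_one_plus_ideal_transcendental:
  fixes lam :: "'a::field"
  assumes "lam \<noteq> 0"
    and transc: "\<And>P :: int poly. P \<noteq> 0 \<Longrightarrow> poly (map_poly of_int P) lam \<noteq> 0"
  shows "0 \<notin> one_plus_ideal (inverse lam)"
proof
  assume "0 \<in> one_plus_ideal (inverse lam)"
  then obtain n c where n: "lam ^ Suc n = (\<Sum>i\<le>n. of_int (c i) * lam ^ i)"
    using zero_in_one_plus_ideal_imp_integral assms(1) by metis
  define Q where "Q = monom 1 (Suc n) + - (\<Sum>i\<le>n. monom (c i) i)"
  \<comment> \<open>The relation is monic, hence nonzero already as an integer polynomial.\<close>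
  have "coeff Q (Suc n) = 1"
    by (simp add: Q_def coeff_sum)
  hence "Q \<noteq> 0"
    by auto
  moreover have map_poly_sum: "map_poly of_int (sum f I) = (\<Sum>i\<in>I. map_poly of_int (f i) :: 'a poly)"
    for f and I :: "nat set"
    by (induction I rule: infinite_finite_induct) (simp_all add: map_poly_of_int_add)
  have "poly (map_poly of_int Q) lam = 0"
    unfolding Q_def map_poly_of_int_add map_poly_of_int_minus map_poly_sum
    using n by (simp add: map_poly_monom poly_sum poly_monom)
  ultimately show False
    using transc by blast
qed

text \<open>Integrality over a finite prime field leaves only finitely many values for the powers of
  lam, so two of them agree and lam is a root of unity. The set \<open>X\<close> below is the ring
  generated by lam, written with coefficients from the prime field.\<close>

lemma zero_not_in_one_plus_ideal_char_p:
  fixes lam :: "'a::field"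
  assumes "lam \<noteq> 0" "0 < p" "of_nat p = (0 :: 'a)" and root: "\<And>m. 0 < m \<Longrightarrow> lam ^ m \<noteq> 1"
  shows "0 \<notin> one_plus_ideal (inverse lam)"
proof
  assume "0 \<in> one_plus_ideal (inverse lam)"
  then obtain n c where n: "lam ^ Suc n = (\<Sum>i\<le>n. of_int (c i) * lam ^ i)"
    using zero_in_one_plus_ideal_imp_integral assms(1) by metis
  define C where "C = (of_int ` {0..<int p} :: 'a set)"
  have C: "of_int k \<in> C" for k
  proof -
    have "(of_int k :: 'a) = of_int (k mod int p) + of_nat p * of_int (k div int p)"
      by (metis mod_mult_div_eq of_int_add of_int_mult of_int_of_nat_eq)
    hence "(of_int k :: 'a) = of_int (k mod int p)"
      by (simp add: assms)
    thus ?thesis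
      using \<open>0 < p\<close> by (auto simp: C_def)
  qed
  have C_int: "x \<in> C \<Longrightarrow> \<exists>k. x = of_int k" for x
    by (auto simp: C_def)
  define X where "X = (\<lambda>f. \<Sum>i\<le>n. f i * lam ^ i) ` ({..n} \<rightarrow>\<^sub>E C)"
  have "finite X"
    by (auto simp: X_def C_def intro!: finite_PiE)
  have X_I: "(\<Sum>i\<le>n. f i * lam ^ i) \<in> X" if "\<And>i. f i \<in> C" for f
  proof -
    have "(\<Sum>i\<le>n. f i * lam ^ i) = (\<Sum>i\<le>n. restrict f {..n} i * lam ^ i)"
      by (intro sum.cong) auto
    moreover have "restrict f {..n} \<in> {..n} \<rightarrow>\<^sub>E C"
      using that by auto
    ultimately show ?thesis
      unfolding X_def by (rule image_eqI)
  qed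
  have mult: "lam * x \<in> X" if x: "x \<in> X" for x
  proof -
    obtain f where f: "x = (\<Sum>i\<le>n. f i * lam ^ i)" "\<And>i. i \<le> n \<Longrightarrow> f i \<in> C"
      using x by (auto simp: X_def)
    have "\<forall>i. \<exists>k. i \<le> n \<longrightarrow> f i = of_int k"
      using f(2) C_int by blast
    from choice[OF this] obtain g where g: "\<And>i. i \<le> n \<Longrightarrow> f i = of_int (g i)"
      by blast
    \<comment> \<open>Multiplication by lam shifts the coefficients, and the overflow in degree n +
      1 is folded back by the integral relation.\<close>
    define h where "h = (\<lambda>i. (if i = 0 then 0 else g (i - 1)) + g n * c i)"
    have "lam * x = (\<Sum>i\<le>n. of_int (g i) * lam ^ Suc i)"
      using g by (simp add: f(1) sum_distrib_left mult.left_commute)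
    also have "\<dots> = (\<Sum>i\<le>Suc n. of_int (if i = 0 then 0 else g (i - 1)) * lam ^ i)"
      by (subst sum.atMost_Suc_shift) simp
    also have "\<dots> = (\<Sum>i\<le>n. of_int (if i = 0 then 0 else g (i - 1)) * lam ^ i) + of_int (g n) * lam ^ Suc n"
      by simp
    also have "\<dots> = (\<Sum>i\<le>n. of_int (h i) * lam ^ i)"
      by (simp only: n h_def of_int_add of_int_mult sum_distrib_left distrib_right sum.distrib mult.assoc)
    finally show ?thesis
      using X_I[of "\<lambda>i. of_int (h i)"] C by simp
  qed
  have one: "1 \<in> X"
  proof -
    have "1 = (\<Sum>i\<le>n. of_int (if i = 0 then 1 else 0) * lam ^ i)"
      by (simp add: if_distrib[of of_int] if_distrib[of "\<lambda>x. x * _"] cong: if_cong)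
    thus ?thesis
      using X_I[of "\<lambda>i. of_int (if i = 0 then 1 else 0)"] C by simp
  qed
  have "lam ^ k \<in> X" for k
    by (induction k) (use one mult in auto)
  hence "\<not> inj (\<lambda>k. lam ^ k)"
    using \<open>finite X\<close> finite_subset[of "range (\<lambda>k. lam ^ k)" X] finite_imageD[of "\<lambda>k. lam ^ k" UNIV]
    by auto
  then obtain i j where ij: "i < j" "lam ^ i = lam ^ j"
    unfolding inj_def by (metis linorder_neqE_nat)
  have "lam ^ j = lam ^ i * lam ^ (j - i)"
    using ij(1) by (simp flip: power_add)
  hence "lam ^ i * lam ^ (j - i) = lam ^ i * 1"
    using ij(2) by simp
  hence "lam ^ (j - i) = 1"
    using assms(1) by (subst (asm) mult_left_cancel) auto
  thus False
    using root[of "j - i"] ij by simp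
qed

section \<open>Polynomials, iteration and periodic points\<close>

lemma pcompose_monom: "pcompose (monom c d) u = smult c (u ^ d)"
  by (induction d) (auto simp: monom_0 monom_Suc pcompose_pCons)

lemma poly_iter_0: "poly_iter f 0 = [:0, 1:]"
  and poly_iter_Suc: "poly_iter f (Suc n) = pcompose f (poly_iter f n)"
  by (simp_all add: poly_iter_def)

lemma X_eq_monom: "[:0, 1:] = monom 1 1"
  by (simp add: monom_Suc monom_0)

lemma poly_iter_1: "poly_iter f (Suc 0) = f"
  by (simp add: poly_iter_0 poly_iter_Suc)

lemma poly_iter_add: "poly_iter f (m + n) = pcompose (poly_iter f m) (poly_iter f n)"
  by (induction m) (simp_all add: poly_iter_0 poly_iter_Suc pcompose_pCons pcompose_assoc)

lemma poly_iter_Suc': "poly_iter f (Suc n) = pcompose (poly_iter f n) f"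
  using poly_iter_add[of f n 1] by (simp add: poly_iter_1)

lemma poly_iter_mult: "poly_iter f (m * n) = poly_iter (poly_iter f m) n"
  by (induction n) (simp_all add: poly_iter_0 poly_iter_Suc poly_iter_add)

lemma poly_poly_iter: "poly (poly_iter f n) z = (poly f ^^ n) z"
  by (induction n) (simp_all add: poly_iter_0 poly_iter_Suc poly_pcompose)

lemma two_mult_choose_two: "2 * (n choose 2) = n * (n - 1)"
proof -
  have "even (n * (n - 1))"
    by (cases n) auto
  thus ?thesis
    by (simp add: choose_two)
qed

lemma funpow_fixed_dvd: "(g ^^ d) z = z \<Longrightarrow> d dvd m \<Longrightarrow> (g ^^ m) z = z"
proof -
  assume z: "(g ^^ d) z = z" and "d dvd m"
  then obtain k where "m = d * k"
    by blast
  moreover have "((g ^^ d) ^^ k) z = z"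
    using z by (induction k) auto
  ultimately show ?thesis
    by (simp add: funpow_mult)
qed

lemma powr_inverse_power:
  assumes "0 < x" "0 < k"
  shows "(x ^ k) powr (1 / real k) = (x :: real)"
  using assms by (simp add: powr_powr flip: powr_realpow)

section \<open>Factorisation of monic polynomials\<close>

lemma monic_splits:
  assumes "alg_closed_field TYPE('a::field)" and "lead_coeff (P :: 'a poly) = 1"
  shows "\<exists>xs. P = (\<Prod>x\<leftarrow>xs. [:- x, 1:])"
  using assms(2)
proof (induction "degree P" arbitrary: P)
  case 0
  hence "P = [:1:]"
    by (metis coeff_pCons_0 degree_eq_zeroE)
  thus ?case
    by (intro exI[of _ "[]"]) (simp add: one_pCons)
next
  case (Suc n)
  obtain x where "poly P x = 0"
    using assms(1) Suc.hyps(2) unfolding alg_closed_field_def by (metis Suc_le_mono One_nat_def le0)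
  then obtain Q where Q: "P = [:- x, 1:] * Q"
    by (auto simp: poly_eq_0_iff_dvd)
  have "Q \<noteq> 0"
    using Suc.prems Q by auto
  hence "degree P = degree [:- x, 1:] + degree Q"
    unfolding Q by (intro degree_mult_eq) auto
  hence "n = degree Q"
    using Suc.hyps(2) by simp
  moreover have "lead_coeff Q = 1"
    using Suc.prems unfolding Q lead_coeff_mult by simp
  ultimately obtain xs where "Q = (\<Prod>x\<leftarrow>xs. [:- x, 1:])"
    using Suc.hyps(1) by blast
  thus ?case
    using Q by (intro exI[of _ "x # xs"]) simp
qed

text \<open>A root listed twice would be a common zero of \<open>P\<close> and its
  derivative.\<close>

lemma monic_splits_distinct:
  assumes "alg_closed_field TYPE('a::field)" and "lead_coeff (P :: 'a poly) = 1"
    and simple: "\<And>x. poly P x = 0 \<Longrightarrow> poly (pderiv P) x \<noteq> 0"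
  shows "P = (\<Prod>x\<in>{x. poly P x = 0}. [:- x, 1:])"
proof -
  obtain xs where xs: "P = (\<Prod>x\<leftarrow>xs. [:- x, 1:])"
    using monic_splits[OF assms(1,2)] by blast
  have "distinct xs"
  proof (rule ccontr)
    assume "\<not> distinct xs"
    then obtain as y bs cs where "xs = as @ [y] @ bs @ [y] @ cs"
      using not_distinct_decomp by blast
    hence P: "P = [:- y, 1:] * ([:- y, 1:] * (\<Prod>x\<leftarrow>as @ bs @ cs. [:- x, 1:]))"
      by (simp only: xs map_append prod_list.append list.map prod_list.Cons prod_list.Nil) (simp only: mult_ac mult_1)
    have "poly P y = 0" "poly (pderiv P) y = 0"
      unfolding P by (simp_all only: pderiv_mult poly_mult poly_add) simp_all
    thus False
      using simple by blast
  qed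
  moreover have "poly (\<Prod>x\<leftarrow>xs. [:- x, 1:]) y = 0 \<longleftrightarrow> y \<in> set xs" for y
    by (induction xs) auto
  hence "{x. poly P x = 0} = set xs"
    by (auto simp: xs)
  ultimately show ?thesis
    using xs by (simp add: prod.distinct_set_conv_list)
qed

lemma prod_less_1:
  fixes f :: "'b \<Rightarrow> real"
  assumes "finite A" "A \<noteq> {}" "\<And>x. x \<in> A \<Longrightarrow> 0 \<le> f x" "\<And>x. x \<in> A \<Longrightarrow> f x < 1"
  shows "prod f A < 1"
  using assms
proof (induction A rule: finite_ne_induct)
  case (insert x A)
  hence "f x * prod f A < 1 * 1"
    by (intro mult_strict_mono') (auto intro: prod_nonneg)
  thus ?case
    using insert.hyps by simp
qed auto

section \<open>Minimal periods and orbits\<close>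

lemma min_period_exists:
  assumes "0 < m" "(f ^^ m) z = z"
  shows "\<exists>d. min_period f z d \<and> d dvd m"
proof -
  define d where "d = (LEAST d. 0 < d \<and> (f ^^ d) z = z)"
  have d: "0 < d \<and> (f ^^ d) z = z"
    unfolding d_def using assms by (intro LeastI) blast
  have min: "\<not> (0 < k \<and> (f ^^ k) z = z)" if "k < d" for k
    using not_less_Least that unfolding d_def by blast
  have "(f ^^ (m mod d)) z = z"
    using funpow_mod_eq[OF conjunct2[OF d], of m] assms by simp
  hence "m mod d = 0"
    using min[of "m mod d"] d by auto
  thus ?thesis
    using d min by (auto simp: min_period_def mod_eq_0_iff_dvd)
qed

lemma card_orbit:
  assumes "min_period f z d"
  shows "orbit f z = (\<lambda>k. (f ^^ k) z) ` {..<d}" "card (orbit f z) = d"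
proof -
  have d: "0 < d" "(f ^^ d) z = z" and min: "\<And>k. 0 < k \<Longrightarrow> k < d \<Longrightarrow> (f ^^ k) z \<noteq> z"
    using assms by (auto simp: min_period_def)
  show eq: "orbit f z = (\<lambda>k. (f ^^ k) z) ` {..<d}"
    unfolding orbit_def
  proof safe
    fix k
    show "(f ^^ k) z \<in> (\<lambda>k. (f ^^ k) z) ` {..<d}"
      using funpow_mod_eq[OF d(2), of k] d(1) by (intro image_eqI[of _ _ "k mod d"]) auto
  qed auto
  have neq: "(f ^^ i) z \<noteq> (f ^^ j) z" if "i < j" "j < d" for i j
  proof
    assume "(f ^^ i) z = (f ^^ j) z"
    hence "(f ^^ (d - j)) ((f ^^ i) z) = (f ^^ (d - j)) ((f ^^ j) z)"
      by simp
    hence "(f ^^ (d - j + i)) z = (f ^^ (d - j + j)) z"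
      by (simp only: funpow_add comp_apply)
    moreover have "0 < d - j + i" "d - j + i < d" "d - j + j = d"
      using that by linarith+
    ultimately show False
      using d min by metis
  qed
  have "inj_on (\<lambda>k. (f ^^ k) z) {..<d}"
    by (rule inj_onI) (metis lessThan_iff linorder_neqE_nat neq)
  thus "card (orbit f z) = d"
    by (simp add: eq card_image)
qed

section \<open>Reduction of polynomials over an ultrametric field\<close>

locale ultrametric_field =
  fixes av :: "'a::field \<Rightarrow> real"
  assumes ultra: "ultrametric_abs av"
begin

lemma av_nonneg [simp]: "0 \<le> av x"
  and av_eq_0_iff [simp]: "av x = 0 \<longleftrightarrow> x = 0"
  and av_mult: "av (x * y) = av x * av y"
  and av_add_max: "av (x + y) \<le> max (av x) (av y)"
  using ultra unfolding ultrametric_abs_def by auto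

lemma av_0 [simp]: "av 0 = 0"
  by simp

lemma av_1 [simp]: "av 1 = 1"
proof -
  have "av 1 = av 1 * av 1"
    by (metis av_mult mult_1)
  thus ?thesis
    by simp
qed

lemma av_minus [simp]: "av (- x) = av x"
proof -
  have "av (-1) * av (-1) = 1"
    by (metis av_1 av_mult mult_minus1 minus_minus)
  hence "av (-1) = 1"
    by (metis abs_of_nonneg av_nonneg real_sqrt_abs2 real_sqrt_one)
  thus ?thesis
    by (metis av_mult mult_1 mult_minus1)
qed

lemma av_diff_max: "av (x - y) \<le> max (av x) (av y)"
  using av_add_max[of x "- y"] by simp

lemma av_diff_commute: "av (x - y) = av (y - x)"
  by (metis av_minus minus_diff_eq)

lemma av_add_le: "av x \<le> c \<Longrightarrow> av y \<le> c \<Longrightarrow> av (x + y) \<le> c"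
  using av_add_max[of x y] by auto

lemma av_add_less: "av x < c \<Longrightarrow> av y < c \<Longrightarrow> av (x + y) < c"
  using av_add_max[of x y] by auto

lemma av_diff_le: "av x \<le> c \<Longrightarrow> av y \<le> c \<Longrightarrow> av (x - y) \<le> c"
  using av_diff_max[of x y] by auto

lemma av_diff_less: "av x < c \<Longrightarrow> av y < c \<Longrightarrow> av (x - y) < c"
  using av_diff_max[of x y] by auto

text \<open>The isosceles principle. For \<open>av x = 1\<close> it says that being a unit depends
  only on the reduction.\<close>

lemma av_eq_if_diff_less: "av (x - y) < av x \<Longrightarrow> av y = av x"
  using av_add_max[of "x - y" y] av_diff_max[of x "x - y"] by (auto simp: max_def split: if_splits)

lemma av_power: "av (x ^ n) = av x ^ n"
  by (induction n) (auto simp: av_mult)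

lemma av_prod: "av (prod f A) = (\<Prod>x\<in>A. av (f x))"
  by (induction A rule: infinite_finite_induct) (auto simp: av_mult)

lemma av_inverse: "av (inverse x) = inverse (av x)"
proof (cases "x = 0")
  case False
  hence "av (inverse x) * av x = 1"
    by (metis av_1 av_mult left_inverse)
  thus ?thesis
    by (metis inverse_unique mult.commute)
qed auto

lemma av_divide: "av (x / y) = av x / av y"
  by (simp add: divide_inverse av_mult av_inverse)

lemma av_mult_le_1: "av x \<le> 1 \<Longrightarrow> av y \<le> 1 \<Longrightarrow> av (x * y) \<le> 1"
  by (simp add: av_mult mult_le_one)

lemma av_mult_less_1: "av x < 1 \<Longrightarrow> av y \<le> 1 \<Longrightarrow> av (x * y) < 1"
  using mult_left_le[of "av y" "av x"] by (simp add: av_mult)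

lemma av_mult_less_1': "av x \<le> 1 \<Longrightarrow> av y < 1 \<Longrightarrow> av (x * y) < 1"
  using av_mult_less_1[of y x] by (simp add: mult.commute)

lemma av_power_le_1: "av x \<le> 1 \<Longrightarrow> av (x ^ n) \<le> 1"
  by (simp add: av_power power_le_one)

lemma av_sum_le: "0 \<le> c \<Longrightarrow> (\<And>i. i \<in> I \<Longrightarrow> av (f i) \<le> c) \<Longrightarrow> av (sum f I) \<le> c"
  by (induction I rule: infinite_finite_induct) (auto intro!: av_add_le)

lemma av_sum_less: "0 < c \<Longrightarrow> (\<And>i. i \<in> I \<Longrightarrow> av (f i) < c) \<Longrightarrow> av (sum f I) < c"
  by (induction I rule: infinite_finite_induct) (auto intro!: av_add_less)

lemma av_of_nat_le_1 [simp]: "av (of_nat n) \<le> 1"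
  by (induction n) (auto intro!: av_add_le)

lemma av_numeral_le_1 [simp]: "av (numeral n) \<le> 1"
  using av_of_nat_le_1[of "numeral n"] by simp

lemma av_of_int_le_1 [simp]: "av (of_int n) \<le> 1"
  by (cases n) (auto simp: simp del: of_nat_Suc)

text \<open>The polynomials over \<open>O\<^sub>K\<close> whose reduction is divisible by \<open>X ^ M\<close>.\<close>

definition red_ideal :: "nat \<Rightarrow> 'a poly set" where
  "red_ideal M = {f. (\<forall>j. av (coeff f j) \<le> 1) \<and> (\<forall>j<M. av (coeff f j) < 1)}"

lemma red_ideal_coeff_le: "f \<in> red_ideal M \<Longrightarrow> av (coeff f j) \<le> 1"
  and red_ideal_coeff_less: "f \<in> red_ideal M \<Longrightarrow> j < M \<Longrightarrow> av (coeff f j) < 1"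
  by (auto simp: red_ideal_def)

lemma red_ideal_mono: "f \<in> red_ideal M \<Longrightarrow> N \<le> M \<Longrightarrow> f \<in> red_ideal N"
  by (auto simp: red_ideal_def)

lemma red_ideal_0 [simp]: "0 \<in> red_ideal M"
  by (auto simp: red_ideal_def)

lemma red_ideal_add: "f \<in> red_ideal M \<Longrightarrow> g \<in> red_ideal M \<Longrightarrow> f + g \<in> red_ideal M"
  by (auto simp: red_ideal_def intro!: av_add_le av_add_less)

lemma red_ideal_diff: "f \<in> red_ideal M \<Longrightarrow> g \<in> red_ideal M \<Longrightarrow> f - g \<in> red_ideal M"
  by (auto simp: red_ideal_def intro!: av_diff_le av_diff_less)

lemma red_ideal_minus_iff [simp]: "- f \<in> red_ideal M \<longleftrightarrow> f \<in> red_ideal M"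
  by (auto simp: red_ideal_def)

lemma red_ideal_sum: "(\<And>i. i \<in> I \<Longrightarrow> f i \<in> red_ideal M) \<Longrightarrow> sum f I \<in> red_ideal M"
  by (induction I rule: infinite_finite_induct) (auto intro!: red_ideal_add)

lemma red_ideal_monom: "av c \<le> 1 \<Longrightarrow> M \<le> d \<Longrightarrow> monom c d \<in> red_ideal M"
  by (auto simp: red_ideal_def)

lemma red_ideal_monom_small: "av c < 1 \<Longrightarrow> monom c d \<in> red_ideal M"
  by (auto simp: red_ideal_def)

lemma red_ideal_mult:
  assumes "f \<in> red_ideal M" "g \<in> red_ideal N"
  shows "f * g \<in> red_ideal (M + N)"
  unfolding red_ideal_def
proof safe
  show "av (coeff (f * g) j) \<le> 1" for j
    unfolding coeff_mult using assms
    by (intro av_sum_le av_mult_le_1) (auto dest: red_ideal_coeff_le)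
  show "av (coeff (f * g) j) < 1" if "j < M + N" for j
    unfolding coeff_mult
  proof (intro av_sum_less)
    fix i assume "i \<in> {..j}"
    hence "i < M \<or> j - i < N" using that by auto
    thus "av (coeff f i * coeff g (j - i)) < 1"
      using assms by (auto intro: av_mult_less_1 av_mult_less_1' dest: red_ideal_coeff_le red_ideal_coeff_less)
  qed auto
qed

lemma red_ideal_mult_left: "f \<in> red_ideal M \<Longrightarrow> g \<in> red_ideal 0 \<Longrightarrow> f * g \<in> red_ideal M"
  using red_ideal_mult[of f M g 0] by simp

lemma red_ideal_smult: "av c \<le> 1 \<Longrightarrow> f \<in> red_ideal M \<Longrightarrow> smult c f \<in> red_ideal M"
  by (auto simp: red_ideal_def intro: av_mult_le_1 av_mult_less_1')

lemma red_ideal_smult_small: "av c < 1 \<Longrightarrow> f \<in> red_ideal 0 \<Longrightarrow> smult c f \<in> red_ideal M"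
  by (auto simp: red_ideal_def intro: av_mult_le_1 av_mult_less_1)

lemma red_ideal_1: "1 \<in> red_ideal 0"
  by (auto simp: red_ideal_def)

lemma red_ideal_pCons_iff:
  "pCons c f \<in> red_ideal (Suc M) \<longleftrightarrow> av c < 1 \<and> f \<in> red_ideal M"
  by (auto simp: red_ideal_def coeff_pCons less_Suc_eq_0_disj split: nat.splits intro: less_imp_le)

lemma red_ideal_pCons_0_iff: "pCons c f \<in> red_ideal 0 \<longleftrightarrow> av c \<le> 1 \<and> f \<in> red_ideal 0"
  by (auto simp: red_ideal_def coeff_pCons split: nat.splits)

lemma red_ideal_X: "[:0, 1:] \<in> red_ideal 1"
  by (auto simp: red_ideal_pCons_iff red_ideal_pCons_0_iff)

lemma red_ideal_pcompose:
  "f \<in> red_ideal M \<Longrightarrow> u \<in> red_ideal N \<Longrightarrow> pcompose f u \<in> red_ideal (M * N)"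
proof (induction f arbitrary: M)
  case (pCons c f)
  show ?case
  proof (cases M)
    case 0
    have "u \<in> red_ideal 0"
      using pCons.prems(2) red_ideal_mono by blast
    moreover have "pcompose f u \<in> red_ideal 0"
      using pCons.IH[of 0] pCons.prems 0 by (simp add: red_ideal_pCons_0_iff)
    ultimately show ?thesis
      using 0 pCons.prems
      by (auto simp: pcompose_pCons red_ideal_pCons_0_iff intro!: red_ideal_add red_ideal_mult_left)
  next
    case (Suc M')
    hence "av c < 1" "f \<in> red_ideal M'"
      using pCons.prems by (auto simp: red_ideal_pCons_iff)
    hence "u * pcompose f u \<in> red_ideal (M * N)"
      using red_ideal_mult[OF pCons.prems(2) pCons.IH] pCons.prems(2) Suc by (simp add: algebra_simps)
    moreover have "[:c:] \<in> red_ideal (M * N)"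
      using \<open>av c < 1\<close> red_ideal_monom_small[of c 0] by (simp add: monom_0)
    ultimately show ?thesis
      by (auto simp: pcompose_pCons intro: red_ideal_add)
  qed
qed auto

text \<open>For j >= 1 the difference (u + v)^j - u^j is \<open>v\<close> times a form of degree j -
  1 in series of order at least 1; this gives order at least M + j, and j = 0 contributes
  nothing.\<close>

lemma red_ideal_pcompose_diff:
  "f \<in> red_ideal s \<Longrightarrow> u \<in> red_ideal 1 \<Longrightarrow> v \<in> red_ideal (Suc M) \<Longrightarrow>
     pcompose f (u + v) - pcompose f u \<in> red_ideal (s + M)"
proof (induction f arbitrary: s)
  case (pCons c f)
  have uv: "u + v \<in> red_ideal 1"
    using pCons.prems red_ideal_mono[of v "Suc M" 1] by (auto intro: red_ideal_add)
  have eq: "pcompose (pCons c f) (u + v) - pcompose (pCons c f) u =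
      (u + v) * (pcompose f (u + v) - pcompose f u) + v * pcompose f u"
    by (simp add: pcompose_pCons algebra_simps)
  \<comment> \<open>The subtraction is truncated: for \<open>s = 0\<close> the order obtained is one
    better than claimed.\<close>
  define s' where "s' = s - 1"
  have f: "f \<in> red_ideal s'"
    using pCons.prems(1) by (cases s) (auto simp: s'_def red_ideal_pCons_iff red_ideal_pCons_0_iff)
  have "(u + v) * (pcompose f (u + v) - pcompose f u) \<in> red_ideal (1 + (s' + M))"
    using red_ideal_mult[OF uv pCons.IH[OF f pCons.prems(2,3)]] .
  moreover have "v * pcompose f u \<in> red_ideal (Suc M + s' * 1)"
    by (intro red_ideal_mult red_ideal_pcompose f pCons.prems)
  ultimately have "(u + v) * (pcompose f (u + v) - pcompose f u) + v * pcompose f u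
      \<in> red_ideal (Suc (s' + M))"
    by (intro red_ideal_add) (simp_all add: add.commute)
  thus ?case
    unfolding eq by (rule red_ideal_mono) (auto simp: s'_def)
qed auto

lemma red_ideal_pcompose_shift:
  assumes "f \<in> red_ideal s" "h - [:0, 1:] \<in> red_ideal (Suc i)"
  shows "pcompose f h - f \<in> red_ideal (s + i)"
  using red_ideal_pcompose_diff[OF assms(1) red_ideal_X assms(2)] by simp

text \<open>The reduction has order exactly \<open>d\<close>. The leading monomial is split off so
  that products and composites can be handled through their leading terms;
  \<open>red_ord_iff\<close> translates to coefficients.\<close>

definition red_ord :: "nat \<Rightarrow> 'a poly \<Rightarrow> bool" where
  "red_ord d f \<longleftrightarrow> (\<exists>a. av a = 1 \<and> f - monom a d \<in> red_ideal (Suc d))"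

lemma red_ideal_split:
  assumes "f \<in> red_ideal d"
  shows "f - monom (coeff f d) d \<in> red_ideal (Suc d)"
  using assms unfolding red_ideal_def by (auto simp: less_Suc_eq)

lemma red_ord_iff: "red_ord d f \<longleftrightarrow> f \<in> red_ideal d \<and> av (coeff f d) = 1"
proof
  assume "red_ord d f"
  then obtain a where a: "av a = 1" "f - monom a d \<in> red_ideal (Suc d)"
    unfolding red_ord_def by blast
  have "(f - monom a d) + monom a d \<in> red_ideal d"
    using a by (intro red_ideal_add red_ideal_monom red_ideal_mono[OF a(2)]) auto
  moreover have "av (coeff f d - a) < 1"
    using red_ideal_coeff_less[OF a(2), of d] by simp
  hence "av (coeff f d) = 1"
    using a(1) av_eq_if_diff_less[of a "coeff f d"] by (simp add: av_diff_commute)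
  ultimately show "f \<in> red_ideal d \<and> av (coeff f d) = 1"
    by simp
next
  assume "f \<in> red_ideal d \<and> av (coeff f d) = 1"
  thus "red_ord d f"
    unfolding red_ord_def using red_ideal_split by blast
qed

lemma red_ord_unique: "red_ord d f \<Longrightarrow> red_ord e f \<Longrightarrow> d = e"
  by (metis linorder_neqE_nat less_irrefl red_ideal_coeff_less red_ord_iff)

lemma red_ord_not_ideal: "red_ord d f \<Longrightarrow> d < M \<Longrightarrow> f \<notin> red_ideal M"
  by (metis less_irrefl red_ideal_coeff_less red_ord_iff)

lemma red_ord_or_ideal:
  assumes "f \<in> red_ideal 0"
  shows "f \<in> red_ideal M \<or> (\<exists>d<M. red_ord d f)"
proof (induction M)
  case (Suc M)
  show ?case
  proof (cases "f \<in> red_ideal M")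
    case True
    hence "f \<in> red_ideal (Suc M) \<or> red_ord M f"
      unfolding red_ord_iff red_ideal_def by (force simp: less_Suc_eq order.order_iff_strict)
    thus ?thesis
      by blast
  next
    case False
    thus ?thesis
      using Suc less_SucI by blast
  qed
qed (use assms in auto)

lemma red_ord_cong:
  assumes "red_ord d f" "g - f \<in> red_ideal M" "d < M"
  shows "red_ord d g"
proof -
  obtain a where a: "av a = 1" "f - monom a d \<in> red_ideal (Suc d)"
    using assms unfolding red_ord_def by blast
  have "(g - f) + (f - monom a d) \<in> red_ideal (Suc d)"
    using assms a by (intro red_ideal_add) (auto elim: red_ideal_mono)
  thus ?thesis
    using a unfolding red_ord_def by auto
qed

lemma red_ord_mult:
  assumes "red_ord d f" "red_ord e g"
  shows "red_ord (d + e) (f * g)"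
proof -
  obtain a b where a: "av a = 1" "f - monom a d \<in> red_ideal (Suc d)"
    and b: "av b = 1" "g - monom b e \<in> red_ideal (Suc e)"
    using assms unfolding red_ord_def by blast
  have "(f - monom a d) * g + monom a d * (g - monom b e) \<in> red_ideal (Suc (d + e))"
    using red_ideal_mult[OF a(2), of g e] red_ideal_mult[OF red_ideal_monom[of a d d] b(2)] a assms(2)
    by (intro red_ideal_add) (auto simp: red_ord_iff)
  moreover have "(f - monom a d) * g + monom a d * (g - monom b e) = f * g - monom (a * b) (d + e)"
    by (simp add: algebra_simps mult_monom)
  ultimately show ?thesis
    using a b unfolding red_ord_def by (metis av_mult mult_1)
qed

lemma red_ord_power: "red_ord d f \<Longrightarrow> red_ord (k * d) (f ^ k)"
proof (induction k)
  case 0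
  show ?case
    by (auto simp: red_ord_iff red_ideal_1)
qed (auto intro: red_ord_mult)

lemma red_ord_smult: "av c = 1 \<Longrightarrow> red_ord d f \<Longrightarrow> red_ord d (smult c f)"
  by (auto simp: red_ord_iff av_mult intro: red_ideal_smult)

lemma red_ord_pcompose:
  assumes "red_ord d f" "red_ord e u" "0 < e"
  shows "red_ord (d * e) (pcompose f u)"
proof -
  obtain a where a: "av a = 1" "f - monom a d \<in> red_ideal (Suc d)"
    using assms unfolding red_ord_def by blast
  have "pcompose (f - monom a d) u \<in> red_ideal (Suc d * e)"
    using a assms by (intro red_ideal_pcompose) (auto simp: red_ord_iff)
  hence "pcompose f u - smult a (u ^ d) \<in> red_ideal (Suc d * e)"
    by (simp add: pcompose_diff pcompose_monom)
  moreover have "red_ord (d * e) (smult a (u ^ d))"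
    using a assms by (intro red_ord_smult red_ord_power)
  ultimately show ?thesis
    using assms(3) red_ord_cong by (metis add_less_cancel_right add_0 mult_Suc)
qed

section \<open>Leading terms of powers, and iteration modulo a power of X\<close>

lemma red_ideal_split_terms:
  assumes "f \<in> red_ideal d"
  shows "f - (monom (coeff f d) d + monom (coeff f (d + 1)) (d + 1)) \<in> red_ideal (d + 2)"
    and "f - (monom (coeff f d) d + monom (coeff f (d + 1)) (d + 1) + monom (coeff f (d + 2)) (d + 2))
      \<in> red_ideal (d + 3)"
proof -
  have 1: "f - monom (coeff f d) d \<in> red_ideal (d + 1)"
    using red_ideal_split[OF assms] by simp
  have 2: "f - monom (coeff f d) d - monom (coeff f (d + 1)) (d + 1) \<in> red_ideal (d + 2)"
    using red_ideal_split[OF 1] by simp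
  have 3: "f - monom (coeff f d) d - monom (coeff f (d + 1)) (d + 1) - monom (coeff f (d + 2)) (d + 2)
      \<in> red_ideal (d + 3)"
    using red_ideal_split[OF 2] by (simp add: eval_nat_numeral)
  show "f - (monom (coeff f d) d + monom (coeff f (d + 1)) (d + 1)) \<in> red_ideal (d + 2)"
    using 2 by (simp add: diff_diff_add)
  show "f - (monom (coeff f d) d + monom (coeff f (d + 1)) (d + 1) + monom (coeff f (d + 2)) (d + 2))
      \<in> red_ideal (d + 3)"
    using 3 by (simp add: diff_diff_add add_ac)
qed

lemma av_power_minus_1_less:
  assumes "av (x - 1) < 1"
  shows "av (x ^ n - 1) < 1"
proof (induction n)
  case (Suc n)
  have x: "av x \<le> 1"
    using av_add_less[of "x - 1" 2 1] assms av_add_max[of "x - 1" 1] by auto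
  have "x ^ Suc n - 1 = x * (x ^ n - 1) + (x - 1)"
    by (simp add: algebra_simps)
  also have "av \<dots> < 1"
    using Suc assms x by (intro av_add_less av_mult_less_1') auto
  finally show ?case .
qed auto

lemma av_sum_powers:
  assumes "av (x - 1) < 1"
  shows "av ((\<Sum>i<r. x ^ i) - of_nat r) < 1"
proof -
  have "(\<Sum>i<r. x ^ i) - of_nat r = (\<Sum>i<r. x ^ i - 1)"
    by (simp add: sum_subtractf)
  also have "av \<dots> < 1"
    using assms by (intro av_sum_less av_power_minus_1_less) auto
  finally show ?thesis .
qed

lemma power_leading_term:
  assumes "f - monom a d \<in> red_ideal (Suc d)" "av a \<le> 1"
  shows "f ^ k - monom (a ^ k) (k * d) \<in> red_ideal (Suc (k * d))"
proof (induction k)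
  case 0
  have "1 - monom (1 :: 'a) 0 = 0"
    by (simp add: monom_0 one_pCons)
  thus ?case
    by simp
next
  case (Suc k)
  have "f - monom a d + monom a d \<in> red_ideal d"
    using assms by (intro red_ideal_add red_ideal_monom red_ideal_mono[OF assms(1)]) auto
  hence f: "f \<in> red_ideal d"
    by simp
  have "(f ^ k - monom (a ^ k) (k * d)) * f \<in> red_ideal (Suc (Suc k * d))"
    using red_ideal_mult[OF Suc f] by (simp add: add_ac)
  moreover have "monom (a ^ k) (k * d) * (f - monom a d) \<in> red_ideal (Suc (Suc k * d))"
    using red_ideal_mult[OF red_ideal_monom[of "a ^ k" "k * d" "k * d"] assms(1)] assms(2)
    by (simp add: av_power_le_1 add_ac)
  ultimately have "(f ^ k - monom (a ^ k) (k * d)) * f + monom (a ^ k) (k * d) * (f - monom a d)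
      \<in> red_ideal (Suc (Suc k * d))"
    by (rule red_ideal_add)
  also have "(f ^ k - monom (a ^ k) (k * d)) * f + monom (a ^ k) (k * d) * (f - monom a d) =
      f ^ Suc k - monom (a ^ Suc k) (Suc k * d)"
    by (simp add: algebra_simps mult_monom)
  finally show ?case .
qed

text \<open>The first two terms of the binomial expansion; since i >= 1, terms quadratic in the
  increment lie beyond degree s + i.\<close>

lemma power_shift_leading_term:
  assumes "1 \<le> i" "av w \<le> 1" "h - [:0, 1:] - monom w (i + 1) \<in> red_ideal (i + 2)"
  shows "h ^ s - monom 1 s - monom (of_nat s * w) (s + i) \<in> red_ideal (s + i + 1)"
proof (induction s)
  case 0
  have "1 - monom (1 :: 'a) 0 = 0"
    by (simp add: monom_0 one_pCons)
  thus ?case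
    by simp
next
  case (Suc s)
  define W where "W = h - [:0, 1:]"
  have "W - monom w (i + 1) + monom w (i + 1) \<in> red_ideal (i + 1)"
    using assms unfolding W_def by (intro red_ideal_add red_ideal_monom red_ideal_mono[OF assms(3)]) auto
  hence W: "W \<in> red_ideal (i + 1)"
    by simp
  hence "W + [:0, 1:] \<in> red_ideal 1"
    by (intro red_ideal_add red_ideal_X) (auto intro: red_ideal_mono)
  hence h: "h \<in> red_ideal 1"
    by (simp add: W_def)
  define D where "D = h ^ s - monom 1 s - monom (of_nat s * w) (s + i)"
  have "D * h \<in> red_ideal (s + i + 2)"
    using red_ideal_mult[OF Suc h] by (simp add: D_def)
  moreover have "monom (of_nat s * w) (s + i) * W \<in> red_ideal (s + i + 2)"
    using assms W by (intro red_ideal_mono[OF red_ideal_mult[OF red_ideal_monom[of _ "s + i"] W]]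
        av_mult_le_1) auto
  moreover have "monom 1 s * (W - monom w (i + 1)) \<in> red_ideal (s + i + 2)"
    using red_ideal_mult[OF red_ideal_monom[of 1 s s] assms(3)] by (simp add: W_def add_ac)
  ultimately have "D * h + monom (of_nat s * w) (s + i) * W + monom 1 s * (W - monom w (i + 1))
      \<in> red_ideal (s + i + 2)"
    by (rule red_ideal_add[OF red_ideal_add])
  also have "D * h + monom (of_nat s * w) (s + i) * W + monom 1 s * (W - monom w (i + 1)) =
      h ^ Suc s - monom 1 (Suc s) - monom (of_nat (Suc s) * w) (Suc s + i)"
    by (simp add: D_def W_def X_eq_monom algebra_simps mult_monom add_monom [symmetric])
  finally show ?case
    by simp
qed

lemma poly_iter_in_red_ideal_1: "f \<in> red_ideal 1 \<Longrightarrow> poly_iter f n \<in> red_ideal 1"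
proof (induction n)
  case (Suc n)
  thus ?case
    using red_ideal_pcompose[of f 1 "poly_iter f n" 1] by (simp add: poly_iter_Suc)
qed (use red_ideal_X in \<open>simp add: poly_iter_0\<close>)

text \<open>Neither operation in the induction loses precision: substituting an iterate of
  \<open>f\<close>, which has order at least 1, keeps a congruence, and \<open>G\<close>, also of
  order at least 1, sends congruent arguments to congruent values.\<close>

lemma semiconjugacy_iter:
  assumes "f \<in> red_ideal 1" "y \<in> red_ideal 1" "G \<in> red_ideal 1"
    and "pcompose y f - pcompose G y \<in> red_ideal (Suc M)"
  shows "pcompose y (poly_iter f n) - pcompose (poly_iter G n) y \<in> red_ideal (Suc M)"
proof (induction n)
  case (Suc n)
  define u where "u = pcompose (poly_iter G n) y"
  have u: "u \<in> red_ideal 1"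
    using red_ideal_pcompose[OF poly_iter_in_red_ideal_1[OF assms(3)] assms(2)] by (simp add: u_def)
  define v where "v = pcompose y (poly_iter f n) - u"
  have v: "v \<in> red_ideal (Suc M)"
    using Suc unfolding v_def u_def .
  have "pcompose (pcompose y f - pcompose G y) (poly_iter f n) \<in> red_ideal (Suc M)"
    using red_ideal_pcompose[OF assms(4) poly_iter_in_red_ideal_1[OF assms(1)]] by simp
  moreover have "pcompose G (u + v) - pcompose G u \<in> red_ideal (Suc M)"
    using red_ideal_pcompose_diff[OF assms(3) u v] by simp
  ultimately have "pcompose (pcompose y f - pcompose G y) (poly_iter f n) +
      (pcompose G (u + v) - pcompose G u) \<in> red_ideal (Suc M)"
    by (rule red_ideal_add)
  thus ?case
    by (simp add: poly_iter_Suc u_def v_def pcompose_diff pcompose_assoc)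
qed (simp add: poly_iter_0 pcompose_pCons)

section \<open>Roots of monic polynomials over O_K and the order of the reduction\<close>

lemma monic_root_le_1:
  assumes P: "lead_coeff P = 1" "P \<in> red_ideal 0" and root: "poly P x = 0"
  shows "av x \<le> 1"
proof (rule ccontr)
  assume "\<not> av x \<le> 1"
  hence x: "1 < av x"
    by simp
  define d where "d = degree P"
  have "poly P x = x ^ d + (\<Sum>i<d. coeff P i * x ^ i)"
    using P(1) by (simp add: poly_altdef d_def lessThan_Suc_atMost [symmetric])
  hence "x ^ d = - (\<Sum>i<d. coeff P i * x ^ i)"
    using root by (simp add: eq_neg_iff_add_eq_0)
  hence "av x ^ d = av (\<Sum>i<d. coeff P i * x ^ i)"
    by (metis av_minus av_power)
  also have "\<dots> < av x ^ d"
  proof (intro av_sum_less)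
    fix i assume "i \<in> {..<d}"
    hence "av x ^ i < av x ^ d"
      using x by (intro power_strict_increasing) auto
    moreover have "av (coeff P i * x ^ i) \<le> 1 * av x ^ i"
      unfolding av_mult av_power using P(2) red_ideal_coeff_le by (intro mult_right_mono) auto
    ultimately show "av (coeff P i * x ^ i) < av x ^ d"
      by simp
  qed (use x in simp)
  finally show False
    by simp
qed

text \<open>A factor with root in the open disc reduces to X, any other to a polynomial with nonzero
  constant term. For a split polynomial this takes the place of Weierstrass preparation.\<close>

lemma red_ord_prod_roots:
  assumes "finite A" "\<And>x. x \<in> A \<Longrightarrow> av x \<le> 1"
  shows "red_ord (card {x\<in>A. av x < 1}) (\<Prod>x\<in>A. [:- x, 1:])"
  using assms
proof (induction A rule: finite_induct)
  case empty
  show ?case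
    by (simp add: red_ord_iff red_ideal_1)
next
  case (insert x A)
  have *: "red_ord (card {y\<in>A. av y < 1}) (\<Prod>x\<in>A. [:- x, 1:])"
    using insert by auto
  show ?case
  proof (cases "av x < 1")
    case True
    hence "{y\<in>insert x A. av y < 1} = insert x {y\<in>A. av y < 1}"
      by auto
    moreover have ord: "red_ord 1 [:- x, 1:]"
      using True unfolding red_ord_iff One_nat_def red_ideal_pCons_iff by (auto simp: red_ideal_pCons_0_iff)
    ultimately show ?thesis
      using red_ord_mult[OF ord *] insert.hyps by (simp del: mult_pCons_left)
  next
    case False
    hence "{y\<in>insert x A. av y < 1} = {y\<in>A. av y < 1}" "av x = 1"
      using insert.prems by force+
    moreover from this have ord: "red_ord 0 [:- x, 1:]"
      unfolding red_ord_iff red_ideal_pCons_0_iff by simp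
    ultimately show ?thesis
      using red_ord_mult[OF ord *] insert.hyps by (simp del: mult_pCons_left)
  qed
qed

end

section \<open>Ramification numbers of series tangent to the identity\<close>

locale ultrametric_residue_field = ultrametric_field av for av :: "'a::field \<Rightarrow> real" +
  fixes p :: nat
  assumes prime_p: "prime p" and odd_p: "odd p" and av_p: "av (of_nat p) < 1"
begin

section \<open>Integers in the residue field\<close>

lemma p_ge_3: "3 \<le> p"
  using prime_p odd_p prime_ge_2_nat[of p] by (cases "p = 2") auto

lemma av_of_nat_less_1: "p dvd n \<Longrightarrow> av (of_nat n) < 1"
  using av_p by (auto simp: dvd_def intro!: av_mult_less_1)

lemma av_of_nat_eq_1:
  assumes "\<not> p dvd n"
  shows "av (of_nat n) = 1"
proof (rule ccontr)
  assume "av (of_nat n) \<noteq> 1"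
  hence less: "av (of_nat n) < 1"
    using av_of_nat_le_1[of n] by linarith
  have "coprime (int n) (int p)"
    using prime_p assms prime_imp_coprime[of p n] by (simp add: coprime_commute)
  then obtain u v where "u * int n + v * int p = 1"
    using bezout_int[of "int n" "int p"] by (metis coprime_iff_gcd_eq_1)
  hence "(of_int u * of_nat n + of_int v * of_nat p :: 'a) = 1"
    by (metis of_int_1 of_int_add of_int_mult of_int_of_nat_eq)
  moreover have "av (of_int u * of_nat n + of_int v * of_nat p) < 1"
    using less av_p by (intro av_add_less av_mult_less_1') auto
  ultimately show False
    by simp
qed

lemma av_of_nat_cong:
  assumes "[m = n] (mod p)"
  shows "av (of_nat m - of_nat n) < 1"
proof -
  have "int p dvd int m - int n"
    using assms by (simp add: cong_iff_dvd_diff flip: cong_int_iff)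
  then obtain k where "int m - int n = int p * k"
    by auto
  hence "(of_nat m - of_nat n :: 'a) = of_nat p * of_int k"
    by (metis of_int_diff of_int_mult of_int_of_nat_eq)
  thus ?thesis
    using av_p by (simp add: av_mult_less_1)
qed

text \<open>By Newton's forward difference formula, the \<open>p\<close>-th iterate of \<open>h\<close> minus the identity is congruent
  modulo \<open>p\<close> to the \<open>p\<close>-th difference.\<close>

fun iter_diff :: "'a poly \<Rightarrow> nat \<Rightarrow> 'a poly" where
  "iter_diff h 0 = [:0, 1:]"
| "iter_diff h (Suc k) = pcompose (iter_diff h k) h - iter_diff h k"

lemma poly_iter_eq_sum_iter_diff:
  "poly_iter h n = (\<Sum>k\<le>n. of_nat (n choose k) * iter_diff h k)"
proof (induction n)
  case (Suc n)
  have "poly_iter h (Suc n) = (\<Sum>k\<le>n. of_nat (n choose k) * pcompose (iter_diff h k) h)"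
    unfolding poly_iter_Suc' Suc.IH by (simp add: pcompose_sum pcompose_smult of_nat_poly)
  also have "\<dots> = (\<Sum>k\<le>n. of_nat (n choose k) * iter_diff h k) +
      (\<Sum>k\<le>n. of_nat (n choose k) * iter_diff h (Suc k))"
    by (simp add: algebra_simps sum.distrib sum_subtractf)
  also have "(\<Sum>k\<le>n. of_nat (n choose k) * iter_diff h k) =
      iter_diff h 0 + (\<Sum>k\<le>n. of_nat (n choose Suc k) * iter_diff h (Suc k))"
  proof -
    have "(\<Sum>k\<le>n. of_nat (n choose k) * iter_diff h k) =
        (\<Sum>k\<le>Suc n. of_nat (n choose k) * iter_diff h k)"
      by (simp add: binomial_eq_0)
    also have "\<dots> = iter_diff h 0 + (\<Sum>k\<le>n. of_nat (n choose Suc k) * iter_diff h (Suc k))"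
      by (subst sum.atMost_Suc_shift) simp
    finally show ?thesis .
  qed
  also have "\<dots> + (\<Sum>k\<le>n. of_nat (n choose k) * iter_diff h (Suc k)) =
      iter_diff h 0 + (\<Sum>k\<le>n. of_nat (Suc n choose Suc k) * iter_diff h (Suc k))"
    by (simp del: iter_diff.simps add: algebra_simps flip: sum.distrib)
  also have "\<dots> = (\<Sum>k\<le>Suc n. of_nat (Suc n choose k) * iter_diff h k)"
    by (subst sum.atMost_Suc_shift) simp
  finally show ?case .
qed (simp add: poly_iter_0)

lemma iter_diff_in:
  assumes "h - [:0, 1:] \<in> red_ideal (Suc i)"
  shows "iter_diff h k \<in> red_ideal (Suc (k * i))"
proof (induction k)
  case (Suc k)
  show ?case
    using red_ideal_pcompose_shift[OF Suc assms] by (simp add: add.commute)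
qed (use red_ideal_X in auto)

lemma sum_binomial_p:
  "(\<Sum>k\<le>p. of_nat (p choose k) * g k) =
     g 0 + g p + (\<Sum>k\<in>{0<..<p}. of_nat (p choose k) * (g k :: 'b::comm_ring_1))"
proof -
  have "{..p} = insert 0 (insert p {0<..<p})"
    using p_ge_3 by auto
  thus ?thesis
    using p_ge_3 by (simp add: add.assoc)
qed

lemma red_ideal_of_nat_mult: "p dvd n \<Longrightarrow> f \<in> red_ideal 0 \<Longrightarrow> of_nat n * f \<in> red_ideal M"
  by (simp add: of_nat_poly red_ideal_smult_small av_of_nat_less_1)

lemma poly_iter_p_cong:
  assumes "h - [:0, 1:] \<in> red_ideal 1"
  shows "poly_iter h p - [:0, 1:] - iter_diff h p \<in> red_ideal M"
proof -
  have "poly_iter h p - [:0, 1:] - iter_diff h p =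
      (\<Sum>k\<in>{0<..<p}. of_nat (p choose k) * iter_diff h k)"
    unfolding poly_iter_eq_sum_iter_diff sum_binomial_p by simp
  also have "\<dots> \<in> red_ideal M"
  proof (intro red_ideal_sum red_ideal_of_nat_mult)
    fix k assume "k \<in> {0<..<p}"
    thus "p dvd (p choose k)"
      using prime_p by (intro dvd_choose_prime) auto
    show "iter_diff h k \<in> red_ideal 0"
      using iter_diff_in[of h 0 k] assms red_ideal_mono by (metis One_nat_def zero_le)
  qed
  finally show ?thesis .
qed

text \<open>Modulo p the iterate minus the identity is a p-th difference, and each difference gains
  at least i in order. This is the inequality i_(n+1) >= p i_n.\<close>

lemma poly_iter_p_in:
  assumes "h - [:0, 1:] \<in> red_ideal (Suc i)"
  shows "poly_iter h p - [:0, 1:] \<in> red_ideal (Suc (p * i))"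
proof -
  have "h - [:0, 1:] \<in> red_ideal 1"
    using assms red_ideal_mono by (metis One_nat_def Suc_le_mono zero_le)
  hence "(poly_iter h p - [:0, 1:] - iter_diff h p) + iter_diff h p \<in> red_ideal (Suc (p * i))"
    using assms by (intro red_ideal_add poly_iter_p_cong iter_diff_in)
  thus ?thesis
    by simp
qed

text \<open>Frobenius is additive on the residue field.\<close>

lemma av_power_p_cong:
  assumes "av x \<le> 1"
  shows "av (((x - 1) ^ p) - (x ^ p - 1)) < 1"
proof -
  have "x ^ p = (\<Sum>k\<le>p. of_nat (p choose k) * (x - 1) ^ k)"
    using binomial_ring[of "x - 1" 1 p] by simp
  also have "\<dots> = 1 + (x - 1) ^ p + (\<Sum>k\<in>{0<..<p}. of_nat (p choose k) * (x - 1) ^ k)"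
    by (subst sum_binomial_p) simp
  finally have eq: "(x - 1) ^ p - (x ^ p - 1) = - (\<Sum>k\<in>{0<..<p}. of_nat (p choose k) * (x - 1) ^ k)"
    by simp
  have "av (\<Sum>k\<in>{0<..<p}. of_nat (p choose k) * (x - 1) ^ k) < 1"
  proof (intro av_sum_less av_mult_less_1 av_power_le_1)
    fix k assume "k \<in> {0<..<p}"
    thus "av (of_nat (p choose k)) < 1"
      using prime_p by (intro av_of_nat_less_1 dvd_choose_prime) auto
    show "av (x - 1) \<le> 1"
      using assms by (intro av_diff_le) auto
  qed auto
  thus ?thesis
    unfolding eq by simp
qed

text \<open>The flag \<open>e\<close> records whether the term quadratic in \<open>A\<close> reaches the second order.\<close>

lemma power_expansion:
  assumes "av A \<le> 1" "av B \<le> 1" "1 \<le> i" and e: "e = (if i = 1 then 1 else 0)"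
    and H: "H - (monom 1 1 + monom A (i + 1) + monom B (i + 2)) \<in> red_ideal (i + 3)"
  shows "H ^ s - (monom 1 s + monom (of_nat s * A) (s + i) +
      monom (of_nat s * B + e * of_nat (s choose 2) * A ^ 2) (s + i + 1)) \<in> red_ideal (s + i + 2)"
proof (induction s)
  case 0
  have "1 - monom (1::'a) 0 = 0"
    by (simp add: monom_0 one_pCons)
  thus ?case
    by (simp add: e numeral_2_eq_2)
next
  case (Suc s)
  define Q1 where "Q1 = monom 1 1 + monom A (i + 1) + monom B (i + 2)"
  define C where "C = (\<lambda>s. of_nat s * B + e * of_nat (s choose 2) * A ^ 2)"
  define Q where "Q = (\<lambda>s. monom 1 s + monom (of_nat s * A) (s + i) + monom (C s) (s + i + 1))"
  have C: "av (C s) \<le> 1" for s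
    using assms unfolding C_def by (auto simp: e intro!: av_add_le av_mult_le_1 av_power_le_1)
  have H1: "H \<in> red_ideal 1"
  proof -
    have "H - Q1 + Q1 \<in> red_ideal 1"
      using H assms unfolding Q1_def
      by (intro red_ideal_add red_ideal_monom red_ideal_mono[OF H]) auto
    thus ?thesis
      by simp
  qed
  have Qs: "Q s \<in> red_ideal s"
    unfolding Q_def using C assms by (intro red_ideal_add red_ideal_monom av_mult_le_1) auto
  have "(H ^ s - Q s) * H \<in> red_ideal (s + i + 3)"
    using red_ideal_mult[OF _ H1, of "H ^ s - Q s" "s + i + 2"] Suc.IH
    unfolding Q_def C_def by (simp add: eval_nat_numeral)
  moreover have "Q s * (H - Q1) \<in> red_ideal (s + i + 3)"
    using red_ideal_mult[OF Qs H] unfolding Q1_def by (simp add: add_ac)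
  moreover have "Q s * Q1 - Q (Suc s) \<in> red_ideal (s + i + 3)"
  proof -
    define R where "R = monom (of_nat s * A * B) (s + 2 * i + 2) + monom (C s * A) (s + 2 * i + 2)
        + monom (C s * B) (s + 2 * i + 3)"
    have R: "R \<in> red_ideal (s + i + 3)"
      unfolding R_def using assms C
      by (intro red_ideal_add red_ideal_monom av_mult_le_1) auto
    have C': "C (Suc s) = C s + B + e * of_nat s * A ^ 2"
      by (simp add: C_def numeral_2_eq_2 algebra_simps)
    \<comment> \<open>All terms match or go into \<open>R\<close>, except s A^2 X^(s + 2 i + 1). It
      has degree s + i + 2 exactly if i = 1, and then \<open>e\<close> adds the same term to
      \<open>C (Suc s)\<close>.\<close>
    have "Q s * Q1 - Q (Suc s) =
        R + (monom (of_nat s * A ^ 2) (s + 2 * i + 1) - monom (e * of_nat s * A ^ 2) (s + i + 2))"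
      unfolding Q_def Q1_def C' R_def
      by (simp add: algebra_simps mult_monom add_monom [symmetric] power2_eq_square numeral_3_eq_3
            numeral_2_eq_2)
    moreover have "monom (of_nat s * A ^ 2) (s + 2 * i + 1) - monom (e * of_nat s * A ^ 2) (s + i + 2)
        \<in> red_ideal (s + i + 3)"
    proof (cases "i = 1")
      case False
      thus ?thesis
        using assms by (auto intro!: red_ideal_monom av_mult_le_1 av_power_le_1)
    qed (simp add: e)
    ultimately show ?thesis
      using R by (auto intro: red_ideal_add)
  qed
  ultimately have "(H ^ s - Q s) * H + Q s * (H - Q1) + (Q s * Q1 - Q (Suc s))
      \<in> red_ideal (s + i + 3)"
    by (intro red_ideal_add)
  also have "(H ^ s - Q s) * H + Q s * (H - Q1) + (Q s * Q1 - Q (Suc s)) = H ^ Suc s - Q (Suc s)"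
    by (simp add: algebra_simps)
  finally show ?case
    by (simp add: Q_def C_def numeral_3_eq_3)
qed

text \<open>Substituting \<open>H\<close> into c X^s contributes to both new coefficients, into d
  X^(s + 1) only to the second; the remainder of \<open>f\<close> moves only from degree s + i + 2
  on.\<close>

lemma shift_expansion:
  assumes "av A \<le> 1" "av B \<le> 1" "1 \<le> i" and e: "e = (if i = 1 then 1 else 0)"
    and H: "H - (monom 1 1 + monom A (i + 1) + monom B (i + 2)) \<in> red_ideal (i + 3)"
    and f: "f - (monom c s + monom d (s + 1)) \<in> red_ideal (s + 2)"
    and "av c \<le> 1" "av d \<le> 1"
  shows "pcompose f H - f -
      (monom (c * of_nat s * A) (s + i) +
       monom (of_nat (s + 1) * A * d + c * (of_nat s * B + e * of_nat (s choose 2) * A ^ 2)) (s + i + 1))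
      \<in> red_ideal (s + i + 2)"
proof -
  define C where "C = of_nat s * B + e * of_nat (s choose 2) * A ^ 2"
  define C' where "C' = of_nat (s + 1) * B + e * of_nat ((s + 1) choose 2) * A ^ 2"
  have C': "av C' \<le> 1"
    using assms unfolding C'_def by (auto simp: e simp del: of_nat_Suc intro!: av_add_le av_mult_le_1 av_power_le_1)
  have HX: "H - [:0, 1:] \<in> red_ideal (Suc i)"
  proof -
    have "(H - (monom 1 1 + monom A (i + 1) + monom B (i + 2))) + (monom A (i + 1) + monom B (i + 2))
        \<in> red_ideal (Suc i)"
      using assms by (intro red_ideal_add red_ideal_monom red_ideal_mono[OF H]) auto
    thus ?thesis
      by (simp add: X_eq_monom algebra_simps)
  qed
  define g where "g = f - (monom c s + monom d (s + 1))"
  have "pcompose g H - g \<in> red_ideal (s + i + 2)"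
    using red_ideal_pcompose_shift[OF f HX] by (simp add: g_def add_ac)
  moreover have "smult c (H ^ s - (monom 1 s + monom (of_nat s * A) (s + i) + monom C (s + i + 1)))
      \<in> red_ideal (s + i + 2)"
    unfolding C_def by (intro red_ideal_smult power_expansion assms)
  \<comment> \<open>For exponent s + 1 the third term of the expansion has degree s + i + 2, so it
    is put back into the error.\<close>
  moreover have "smult d (H ^ (s + 1) - (monom 1 (s + 1) + monom (of_nat (s + 1) * A) (s + 1 + i)
      + monom C' (s + 1 + i + 1))) + smult d (monom C' (s + 1 + i + 1)) \<in> red_ideal (s + i + 2)"
    unfolding C'_def using C'
    by (intro red_ideal_add red_ideal_smult red_ideal_mono[OF power_expansion] assms)
      (auto simp: C'_def intro!: red_ideal_monom)
  ultimately have "(pcompose g H - g) +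
      smult c (H ^ s - (monom 1 s + monom (of_nat s * A) (s + i) + monom C (s + i + 1))) +
      (smult d (H ^ (s + 1) - (monom 1 (s + 1) + monom (of_nat (s + 1) * A) (s + 1 + i)
      + monom C' (s + 1 + i + 1))) + smult d (monom C' (s + 1 + i + 1))) \<in> red_ideal (s + i + 2)"
    by (rule red_ideal_add[OF red_ideal_add])
  also have "(pcompose g H - g) +
      smult c (H ^ s - (monom 1 s + monom (of_nat s * A) (s + i) + monom C (s + i + 1))) +
      (smult d (H ^ (s + 1) - (monom 1 (s + 1) + monom (of_nat (s + 1) * A) (s + 1 + i)
      + monom C' (s + 1 + i + 1))) + smult d (monom C' (s + 1 + i + 1))) =
     pcompose f H - f - (monom (c * of_nat s * A) (s + i) + monom (of_nat (s + 1) * A * d + c * C) (s + i + 1))"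
    unfolding g_def
    by (simp add: pcompose_diff pcompose_add pcompose_monom smult_diff_right smult_add_right
        smult_monom add_monom [symmetric] algebra_simps)
  finally show ?thesis
    unfolding C_def .
qed

text \<open>The step from k to k + 1 multiplies the leading coefficient by s A with s = 1 + k i, and
  s = 1 + k modulo p is a unit as long as the new index is at most p - 2. The last two differences
  are computed separately.\<close>

lemma iter_diff_expansion:
  assumes "av A = 1" "av B \<le> 1" "1 \<le> i" "[i = 1] (mod p)"
    and H: "H - (monom 1 1 + monom A (i + 1) + monom B (i + 2)) \<in> red_ideal (i + 3)"
    and "k \<le> p - 2"
  shows "\<exists>c d. av c = 1 \<and> av d \<le> 1 \<and>
    iter_diff H k - (monom c (1 + k * i) + monom d (1 + k * i + 1)) \<in> red_ideal (1 + k * i + 2)"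
  using \<open>k \<le> p - 2\<close>
proof (induction k)
  case 0
  show ?case
    by (rule exI[of _ 1], rule exI[of _ 0]) (auto simp: monom_Suc monom_0)
next
  case (Suc k)
  define s where "s = 1 + k * i"
  define e where "e = (if i = 1 then 1 else 0 :: 'a)"
  obtain c d where cd: "av c = 1" "av d \<le> 1"
    "iter_diff H k - (monom c s + monom d (s + 1)) \<in> red_ideal (s + 2)"
    using Suc unfolding s_def by auto
  have "[1 + k * i = 1 + k * 1] (mod p)"
    using assms by (intro cong_add cong_mult) auto
  hence "\<not> p dvd s"
    using Suc.prems p_ge_3 unfolding s_def
    by (subst cong_dvd_iff[of _ "1 + k * 1"]) (auto dest!: dvd_imp_le)
  hence "av (c * of_nat s * A) = 1"
    using cd assms by (simp add: av_mult av_of_nat_eq_1)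
  moreover have "av (of_nat (s + 1) * A * d + c * (of_nat s * B + e * of_nat (s choose 2) * A ^ 2)) \<le> 1"
    using cd assms
    by (auto simp: e_def simp del: of_nat_Suc intro!: av_add_le av_mult_le_1 av_power_le_1)
  moreover note shift_expansion[OF _ assms(2,3) e_def H cd(3)]
  ultimately show ?case
    using cd assms
    by (intro exI[of _ "c * of_nat s * A"]
         exI[of _ "of_nat (s + 1) * A * d + c * (of_nat s * B + e * of_nat (s choose 2) * A ^ 2)"])
      (auto simp: s_def add_ac)
qed

text \<open>The exponents \<open>1 + k * i\<close> met on the way hit \<open>0\<close> modulo \<open>p\<close> exactly at \<open>k = p - 1\<close>, and
  \<open>2 + k * i\<close> at \<open>k = p - 2\<close>. Hence the leading term dies in the last step, and of the second term only
  what is created at step \<open>p - 2\<close> survives.\<close>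

lemma poly_iter_p_expansion:
  assumes A: "av A = 1" and B: "av B \<le> 1" and i: "1 \<le> i" "[i = 1] (mod p)"
    and e: "e = (if i = 1 then 1 else 0)"
    and H: "H - (monom 1 1 + monom A (i + 1) + monom B (i + 2)) \<in> red_ideal (i + 3)"
  shows "\<exists>c d. av c = 1 \<and> av (d - c * (B - e * A ^ 2)) < 1 \<and>
    poly_iter H p - [:0, 1:] - monom d (p * i + 2) \<in> red_ideal (p * i + 3)"
proof -
  define r where "r = p - 2"
  have r: "p = Suc (Suc r)"
    using p_ge_3 by (simp add: r_def)
  define s where "s = 1 + r * i"
  define s' where "s' = 1 + Suc r * i"
  have A_le: "av A \<le> 1" and e_le: "av e \<le> 1"
    using A by (auto simp: e)
  obtain c d where cd: "av c = 1" "av d \<le> 1"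
    "iter_diff H r - (monom c s + monom d (s + 1)) \<in> red_ideal (s + 2)"
    using iter_diff_expansion[OF A B i H, of r] unfolding s_def r_def by auto
  define Q where "Q = of_nat s * B + e * of_nat (s choose 2) * A ^ 2"
  define c1 where "c1 = c * of_nat s * A"
  define d1 where "d1 = of_nat (s + 1) * A * d + c * Q"
  have Q_le: "av Q \<le> 1"
    unfolding Q_def using B A e_le by (intro av_add_le av_mult_le_1 av_power_le_1) auto
  have c1_le: "av c1 \<le> 1" and d1_le: "av d1 \<le> 1"
    unfolding c1_def d1_def using cd A Q_le
    by (auto simp del: of_nat_add intro!: av_add_le av_mult_le_1)
  have step1: "iter_diff H (Suc r) - (monom c1 s' + monom d1 (s' + 1)) \<in> red_ideal (s' + 2)"
    using shift_expansion[OF A_le B i(1) e H cd(3)] cd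
    unfolding c1_def d1_def Q_def s'_def s_def by (simp add: add_ac)
  define Q' where "Q' = of_nat s' * B + e * of_nat (s' choose 2) * A ^ 2"
  define c2 where "c2 = c1 * of_nat s' * A"
  define d2 where "d2 = of_nat (s' + 1) * A * d1 + c1 * Q'"
  have step2: "iter_diff H p - (monom c2 (p * i + 1) + monom d2 (p * i + 2)) \<in> red_ideal (p * i + 3)"
  proof -
    have idx: "p * i + 1 = s' + i" "p * i + 2 = s' + i + 1" "p * i + 3 = s' + i + 2"
      by (simp_all add: s'_def r)
    have "iter_diff H p = pcompose (iter_diff H (Suc r)) H - iter_diff H (Suc r)"
      by (simp only: r iter_diff.simps)
    thus ?thesis
      using shift_expansion[OF A_le B i(1) e H step1 c1_le d1_le]
      unfolding c2_def d2_def Q'_def idx by simp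
  qed

  have "[s + 1 = (1 + r * 1) + 1] (mod p)"
    unfolding s_def using i by (intro cong_add cong_mult) auto
  hence "p dvd s + 1"
    by (subst cong_dvd_iff, assumption) (simp add: r)
  have "[s' = 1 + Suc r * 1] (mod p)"
    unfolding s'_def using i by (intro cong_add cong_mult) auto
  hence "p dvd s'"
    by (subst cong_dvd_iff, assumption) (simp add: r)
  have "p dvd s' choose 2"
  proof -
    have "2 * (s' choose 2) = s' * (s' - 1)"
      by (rule two_mult_choose_two)
    hence "p dvd 2 * (s' choose 2)"
      using \<open>p dvd s'\<close> by simp
    moreover have "coprime p 2"
      using odd_p by simp
    ultimately show ?thesis
      using coprime_dvd_mult_right_iff by blast
  qed
  have "av c2 < 1"
    unfolding c2_def using c1_le A_le av_of_nat_less_1[OF \<open>p dvd s'\<close>]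
    by (intro av_mult_less_1 av_mult_less_1')

  have Q': "av Q' < 1"
    unfolding Q'_def using av_of_nat_less_1[OF \<open>p dvd s'\<close>] av_of_nat_less_1[OF \<open>p dvd s' choose 2\<close>]
      A e_le B by (intro av_add_less av_mult_less_1 av_mult_less_1'[of e] av_power_le_1) auto
  \<comment> \<open>Here s = -1 modulo p, so 2 (s choose 2) = s (s - 1) is 2 modulo p, and p is
    odd.\<close>
  have choose_s: "av (of_nat (s choose 2) - 1) < 1"
  proof -
    have "2 * (s choose 2) + 2 * (s + 1) = (s + 1) * s + 2"
      unfolding two_mult_choose_two by (cases s) auto
    hence "of_nat (2 * (s choose 2) + 2 * (s + 1)) = (of_nat ((s + 1) * s + 2) :: 'a)"
      by (simp only:)
    hence "2 * (of_nat (s choose 2) - 1) = of_nat (s + 1) * (of_nat s - 2 :: 'a)"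
      by (simp add: algebra_simps)
    moreover have "av (of_nat (s + 1) * (of_nat s - 2)) < 1"
      by (intro av_mult_less_1 av_of_nat_less_1 \<open>p dvd s + 1\<close> av_diff_le) auto
    ultimately have "av 2 * av (of_nat (s choose 2) - 1) < 1"
      by (metis av_mult)
    moreover have "av 2 = 1"
      using av_of_nat_eq_1[of 2] p_ge_3 dvd_imp_le[of p 2] by auto
    ultimately show ?thesis
      by simp
  qed
  \<comment> \<open>With s = -1 and (s choose 2) = 1 modulo p, \<open>Q\<close> reduces to -(B - e
    A^2).\<close>
  have Q: "av (Q + (B - e * A ^ 2)) < 1"
  proof -
    have "Q + (B - e * A ^ 2) = of_nat (s + 1) * B + e * (of_nat (s choose 2) - 1) * A ^ 2"
      by (simp add: Q_def algebra_simps)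
    also have "av \<dots> < 1"
      using av_of_nat_less_1[OF \<open>p dvd s + 1\<close>] choose_s e_le A B
      by (intro av_add_less av_mult_less_1 av_mult_less_1'[of e] av_power_le_1) auto
    finally show ?thesis .
  qed

  \<comment> \<open>Since s' and s + 1 vanish modulo p, as does \<open>Q'\<close>, what remains of
    \<open>d2\<close> is c A Q. Hence the unit in the conclusion is -c A.\<close>
  have "av (d2 - (- c * A) * (B - e * A ^ 2)) < 1"
  proof -
    have "d2 - (- c * A) * (B - e * A ^ 2) = of_nat s' * (A * d1) + of_nat (s + 1) * (A * A * d) +
        c * A * (Q + (B - e * A ^ 2)) + c1 * Q'"
      by (simp add: d2_def d1_def algebra_simps)
    also have "av \<dots> < 1"
    proof (intro av_add_less)
      show "av (of_nat s' * (A * d1)) < 1" "av (of_nat (s + 1) * (A * A * d)) < 1"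
        using av_of_nat_less_1[OF \<open>p dvd s + 1\<close>] av_of_nat_less_1[OF \<open>p dvd s'\<close>] cd A_le d1_le
        by (auto intro!: av_mult_less_1 av_mult_le_1 simp del: of_nat_add)
      show "av (c * A * (Q + (B - e * A ^ 2))) < 1"
        using Q cd A by (intro av_mult_less_1'[of "c * A"]) (auto simp: av_mult)
      show "av (c1 * Q') < 1"
        using c1_le Q' by (rule av_mult_less_1')
    qed
    finally show ?thesis .
  qed
  moreover have "av (- c * A) = 1"
    using cd A by (simp add: av_mult)
  moreover have "poly_iter H p - [:0, 1:] - monom d2 (p * i + 2) \<in> red_ideal (p * i + 3)"
  proof -
    have "H - (monom 1 1 + monom A (i + 1) + monom B (i + 2)) +
        (monom A (i + 1) + monom B (i + 2)) \<in> red_ideal 1"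
      using A_le B by (intro red_ideal_add red_ideal_monom red_ideal_mono[OF H]) auto
    hence "H - [:0, 1:] \<in> red_ideal 1"
      by (simp add: X_eq_monom algebra_simps)
    hence "(poly_iter H p - [:0, 1:] - iter_diff H p) +
        (iter_diff H p - (monom c2 (p * i + 1) + monom d2 (p * i + 2))) + monom c2 (p * i + 1)
        \<in> red_ideal (p * i + 3)"
      using \<open>av c2 < 1\<close> by (intro red_ideal_add poly_iter_p_cong step2 red_ideal_monom_small)
    thus ?thesis
      by (simp add: X_eq_monom algebra_simps)
  qed
  ultimately show ?thesis
    by blast
qed

text \<open>Comparison of the coefficients of \<open>X ^ (I + 3)\<close> in \<open>H \<circ> h = h \<circ> H\<close>.\<close>

lemma commuting_second_coefficient:
  assumes ab: "av a \<le> 1" "av b \<le> 1"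
    and h: "h - (monom 1 1 + monom a 2 + monom b 3) \<in> red_ideal 4"
    and ABC: "av A \<le> 1" "av B \<le> 1" "av C \<le> 1" and I: "2 \<le> I" "[I = 1] (mod p)"
    and H: "H - (monom 1 1 + monom A (I + 1) + monom B (I + 2) + monom C (I + 3)) \<in> red_ideal (I + 4)"
    and comm: "pcompose H h = pcompose h H"
  shows "av (a * B - A * (b - a ^ 2)) < 1"
proof -
  have h': "h - (monom 1 1 + monom a (1 + 1) + monom b (1 + 2)) \<in> red_ideal (1 + 3)"
    using h by (simp add: eval_nat_numeral)
  have H': "H - (monom 1 1 + monom A (I + 1) + monom B (I + 2)) \<in> red_ideal (I + 3)"
  proof -
    have "H - (monom 1 1 + monom A (I + 1) + monom B (I + 2) + monom C (I + 3)) + monom C (I + 3)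
        \<in> red_ideal (I + 3)"
      using ABC by (intro red_ideal_add red_ideal_monom red_ideal_mono[OF H]) auto
    thus ?thesis
      by (simp add: algebra_simps)
  qed
  have hX: "h - [:0, 1:] \<in> red_ideal (Suc 1)"
  proof -
    have "h - (monom 1 1 + monom a 2 + monom b 3) + (monom a 2 + monom b 3) \<in> red_ideal (Suc 1)"
      using ab by (intro red_ideal_add red_ideal_monom red_ideal_mono[OF h]) auto
    thus ?thesis
      by (simp add: X_eq_monom algebra_simps)
  qed
  have HX: "H - [:0, 1:] \<in> red_ideal (Suc I)"
  proof -
    have "H - (monom 1 1 + monom A (I + 1) + monom B (I + 2)) + (monom A (I + 1) + monom B (I + 2))
       \<in> red_ideal (Suc I)"
      using ABC by (intro red_ideal_add red_ideal_monom red_ideal_mono[OF H']) auto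
    thus ?thesis
      by (simp add: X_eq_monom algebra_simps)
  qed
  define u where "u = of_nat (I + 1) * b + 1 * of_nat ((I + 1) choose 2) * a ^ 2"
  have pow_h: "h ^ s - (monom 1 s + monom (of_nat s * a) (s + 1)
      + monom (of_nat s * b + 1 * of_nat (s choose 2) * a ^ 2) (s + 2)) \<in> red_ideal (s + 3)" for s
    using power_expansion[OF ab, of 1 1 h s] h' by (simp add: eval_nat_numeral)
  have pow_H: "H ^ s - (monom 1 s + monom (of_nat s * A) (s + I) + monom (of_nat s * B) (s + I + 1))
      \<in> red_ideal (s + I + 2)" for s
    using power_expansion[OF ABC(1,2), of I 0 H s] H' I by simp

  \<comment> \<open>\<open>E1\<close> to \<open>E7\<close> are the errors of truncating
    \<open>H\<close>, \<open>h\<close> and the powers met when one is substituted into the other.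
    \<open>L\<close> combines them so that the composites cancel by \<open>comm\<close> and an
    explicit expression is left in degree I + 3.\<close>
  define E1 where "E1 = H - (monom 1 1 + monom A (I + 1) + monom B (I + 2) + monom C (I + 3))"
  define E2 where "E2 = h - (monom 1 1 + monom a 2 + monom b 3)"
  define E3 where "E3 = h ^ (I + 1) - (monom 1 (I + 1) + monom (of_nat (I + 1) * a) (I + 2) + monom u (I + 3))"
  define E4 where "E4 = h ^ (I + 2) - (monom 1 (I + 2) + monom (of_nat (I + 2) * a) (I + 3))"
  define E5 where "E5 = h ^ (I + 3) - monom 1 (I + 3)"
  define E6 where "E6 = H ^ 2 - (monom 1 2 + monom (of_nat 2 * A) (I + 2) + monom (of_nat 2 * B) (I + 3))"
  define E7 where "E7 = H ^ 3 - (monom 1 3 + monom (of_nat 3 * A) (I + 3))"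
  have E1: "pcompose E1 h - E1 \<in> red_ideal (I + 4)"
    using red_ideal_pcompose_shift[OF H hX] red_ideal_mono unfolding E1_def by force
  have E2: "pcompose E2 H - E2 \<in> red_ideal (I + 4)"
    using red_ideal_pcompose_shift[OF h HX] unfolding E2_def by (simp add: add_ac)
  have E3: "smult A E3 \<in> red_ideal (I + 4)"
  proof -
    have idx: "I + 1 + 1 = I + 2" "I + 1 + 2 = I + 3" "I + 1 + 3 = I + 4"
      by simp_all
    show ?thesis
      using pow_h[of "I + 1"] ABC unfolding idx E3_def u_def by (intro red_ideal_smult)
  qed
  have cancel: "f - (x + y + z) + z = f - (x + y)" for f x y z :: "'a poly"
    by simp
  have E4: "smult B E4 \<in> red_ideal (I + 4)"
  proof -
    let ?w = "of_nat (I + 2) * b + 1 * of_nat ((I + 2) choose 2) * a ^ 2"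
    have "av ?w \<le> 1"
      using ab by (intro av_add_le av_mult_le_1 av_power_le_1 av_of_nat_le_1) auto
    moreover have idx: "I + 2 + 1 = I + 3" "I + 2 + 2 = I + 4"
      by simp_all
    ultimately have "h ^ (I + 2) - (monom 1 (I + 2) + monom (of_nat (I + 2) * a) (I + 3) + monom ?w (I + 4))
        + monom ?w (I + 4) \<in> red_ideal (I + 4)"
      by (intro red_ideal_add red_ideal_mono[OF pow_h[of "I + 2", unfolded idx]] red_ideal_monom) auto
    also have "h ^ (I + 2) - (monom 1 (I + 2) + monom (of_nat (I + 2) * a) (I + 3) + monom ?w (I + 4))
        + monom ?w (I + 4) = E4"
      unfolding E4_def by (rule cancel)
    finally show ?thesis
      using ABC by (intro red_ideal_smult)
  qed
  have E5: "smult C E5 \<in> red_ideal (I + 4)"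
    using red_ideal_pcompose_shift[OF red_ideal_monom[of 1 "I + 3" "I + 3"] hX] ABC
    unfolding E5_def by (intro red_ideal_smult) (simp_all add: pcompose_monom add_ac)
  have E6: "smult a E6 \<in> red_ideal (I + 4)"
  proof -
    have idx: "2 + I = I + 2" "I + 2 + 1 = I + 3" "I + 2 + 2 = I + 4"
      by simp_all
    show ?thesis
      using pow_H[of 2, unfolded idx] ab unfolding E6_def by (intro red_ideal_smult)
  qed
  have E7: "smult b E7 \<in> red_ideal (I + 4)"
  proof -
    have "av (of_nat 3 * B) \<le> 1"
      using ABC by (intro av_mult_le_1) (auto simp del: of_nat_numeral)
    moreover have idx: "3 + I = I + 3" "I + 3 + 1 = I + 4"
      by simp_all
    ultimately have "H ^ 3 - (monom 1 3 + monom (of_nat 3 * A) (I + 3) + monom (of_nat 3 * B) (I + 4))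
       + monom (of_nat 3 * B) (I + 4) \<in> red_ideal (I + 4)"
      by (intro red_ideal_add red_ideal_mono[OF pow_H[of 3, unfolded idx]] red_ideal_monom) auto
    also have "H ^ 3 - (monom 1 3 + monom (of_nat 3 * A) (I + 3) + monom (of_nat 3 * B) (I + 4))
       + monom (of_nat 3 * B) (I + 4) = E7"
      unfolding E7_def by (rule cancel)
    finally show ?thesis
      using ab by (intro red_ideal_smult)
  qed
  define L where "L = (pcompose E1 h - E1) + smult A E3 + smult B E4 + smult C E5
      - ((pcompose E2 H - E2) + smult a E6 + smult b E7)"
  have "L \<in> red_ideal (I + 4)"
    unfolding L_def by (intro red_ideal_add red_ideal_diff E1 E2 E3 E4 E5 E6 E7)
  hence "av (coeff L (I + 3)) < 1"
    by (rule red_ideal_coeff_less) simp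
  moreover have "coeff L (I + 3) = 2 * a * B + 3 * b * A - A * u - of_nat (I + 2) * a * B"
  proof -
    have E1h: "pcompose E1 h = pcompose h H - (h + smult A (h ^ (I + 1)) + smult B (h ^ (I + 2))
        + smult C (h ^ (I + 3)))"
      unfolding E1_def using comm by (simp only: pcompose_diff pcompose_add pcompose_monom smult_1_left power_one_right)
    have E2H: "pcompose E2 H = pcompose h H - (H + smult a (H ^ 2) + smult b (H ^ 3))"
      unfolding E2_def by (simp only: pcompose_diff pcompose_add pcompose_monom smult_1_left power_one_right)
    have [simp]: "coeff E1 (I + 3) = coeff H (I + 3) - C"
      unfolding E1_def using I by simp
    have [simp]: "coeff E2 (I + 3) = coeff h (I + 3)"
      unfolding E2_def using I by simp
    have [simp]: "coeff E3 (I + 3) = coeff (h ^ (I + 1)) (I + 3) - u"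
      unfolding E3_def by simp
    have [simp]: "coeff E4 (I + 3) = coeff (h ^ (I + 2)) (I + 3) - of_nat (I + 2) * a"
      unfolding E4_def by simp
    have [simp]: "coeff E5 (I + 3) = coeff (h ^ (I + 3)) (I + 3) - 1"
      unfolding E5_def by simp
    have [simp]: "coeff E6 (I + 3) = coeff (H ^ 2) (I + 3) - 2 * B"
      unfolding E6_def using I by simp
    have [simp]: "coeff E7 (I + 3) = coeff (H ^ 3) (I + 3) - 3 * A"
      unfolding E7_def using I by simp
    show ?thesis
      unfolding L_def E1h E2H
      by (simp only: coeff_add coeff_diff coeff_smult \<open>coeff E1 _ = _\<close> \<open>coeff E2 _ = _\<close> \<open>coeff E3 _ = _\<close>
         \<open>coeff E4 _ = _\<close> \<open>coeff E5 _ = _\<close> \<open>coeff E6 _ = _\<close> \<open>coeff E7 _ = _\<close>) (simp add: ring_distribs)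
  qed
  ultimately have less: "av (2 * a * B + 3 * b * A - A * u - of_nat (I + 2) * a * B) < 1"
    by simp
  have choose: "av (of_nat ((I + 1) choose 2) - 1) < 1"
  proof -
    have "2 * ((I + 1) choose 2) = (I + 1) * I"
      by (simp only: two_mult_choose_two add_diff_cancel_right')
    also have "[(I + 1) * I = (1 + 1) * 1] (mod p)"
      using I by (intro cong_mult cong_add) auto
    finally have "[2 * ((I + 1) choose 2) = 2 * 1] (mod p)"
      by (simp add: numeral_2_eq_2)
    moreover have "coprime 2 p"
      using odd_p by simp
    ultimately have "[(I + 1) choose 2 = 1] (mod p)"
      using cong_mult_lcancel_nat by blast
    thus ?thesis
      using av_of_nat_cong by fastforce
  qed
  have I1: "av (of_nat I - 1) < 1"
    using av_of_nat_cong[OF I(2)] by simp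
  \<comment> \<open>Modulo p, I = 1 makes u equal to 2 b + a^2 and I + 2 equal to 3, so the bracket
    becomes A (b - a^2) - a B.\<close>
  have "a * B - A * (b - a ^ 2) =
      - (2 * a * B + 3 * b * A - A * u - of_nat (I + 2) * a * B)
      - (of_nat I - 1) * (a * B) - (of_nat I - 1) * (A * b)
      - (of_nat ((I + 1) choose 2) - 1) * (A * a ^ 2)"
    by (simp add: u_def algebra_simps)
  also have "av \<dots> < 1"
  proof -
    have "av ((of_nat I - 1) * (a * B)) < 1" "av ((of_nat I - 1) * (A * b)) < 1"
      using I1 ab ABC by (auto intro: av_mult_less_1 av_mult_le_1)
    moreover have "av ((of_nat ((I + 1) choose 2) - 1) * (A * a ^ 2)) < 1"
      using choose ab ABC by (intro av_mult_less_1 av_mult_le_1 av_power_le_1)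
    moreover have "av (- (2 * a * B + 3 * b * A - A * u - of_nat (I + 2) * a * B)) < 1"
      using less by (subst av_minus)
    ultimately show ?thesis
      by (intro av_diff_less)
  qed
  finally show ?thesis .
qed

text \<open>The sum 1 + p + ... + p^n, given by the recursion that the ramification numbers satisfy
  in the minimally ramified case with q = 1.\<close>

fun geom :: "nat \<Rightarrow> nat" where
  "geom 0 = 1"
| "geom (Suc n) = p * geom n + 1"

lemma geom_pos: "1 \<le> geom n"
  by (induction n) auto

lemma geom_cong: "[geom n = 1] (mod p)"
proof (cases n)
  case (Suc m)
  have "[p * geom m + 1 = 0 + 1] (mod p)"
    by (intro cong_add) (auto simp: cong_0_iff)
  thus ?thesis
    using Suc by simp
qed auto

lemma geom_Suc': "geom (Suc n) = geom n + p ^ Suc n"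
  by (induction n) (auto simp: algebra_simps)

lemma geom_eq: "geom n = (p ^ (n + 1) - 1) div (p - 1)"
proof -
  have "geom n * (p - 1) = p ^ (n + 1) - 1"
  proof (induction n)
    case (Suc n)
    have "geom (Suc n) * (p - 1) = geom n * (p - 1) + p ^ Suc n * (p - 1)"
      unfolding geom_Suc' by (simp add: algebra_simps)
    also have "\<dots> = p ^ (Suc n + 1) - 1"
      unfolding Suc using p_ge_3 by (simp add: algebra_simps diff_mult_distrib2 Suc_le_eq)
    finally show ?case .
  qed simp
  thus ?thesis
    using p_ge_3 div_mult_self_is_m[of "p - 1" "geom n"] by simp
qed

text \<open>\<open>red_ord\<close> measures H - X, so order i + 1 stands for ramification number i,
  and order p i + 2 for p i + 1. The deciding unit is the factor B - e A^2 left by the p-th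
  difference.\<close>

lemma red_ord_poly_iter_p:
  assumes i: "1 \<le> i" "[i = 1] (mod p)" and e: "e = (if i = 1 then 1 else 0)"
    and ord: "red_ord (i + 1) (H - [:0, 1:])"
  shows "red_ord (p * i + 2) (poly_iter H p - [:0, 1:]) \<longleftrightarrow>
    av (coeff H (i + 2) - e * coeff H (i + 1) ^ 2) = 1"
proof -
  define A where "A = coeff H (i + 1)"
  define B where "B = coeff H (i + 2)"
  have coeffs: "coeff (H - [:0, 1:]) (i + 1) = A" "coeff (H - [:0, 1:]) (i + 1 + 1) = B"
    using i by (simp_all add: A_def B_def coeff_pCons split: nat.splits)
  have in_ideal: "H - [:0, 1:] \<in> red_ideal (i + 1)" and A: "av A = 1"
    using ord coeffs unfolding red_ord_iff by auto
  have B: "av B \<le> 1"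
    using red_ideal_coeff_le[OF in_ideal, of "i + 1 + 1"] unfolding coeffs .
  have H: "H - (monom 1 1 + monom A (i + 1) + monom B (i + 2)) \<in> red_ideal (i + 3)"
    using red_ideal_split_terms(1)[OF in_ideal, unfolded coeffs]
    by (simp add: X_eq_monom diff_diff_add add_ac eval_nat_numeral)
  obtain c d where cd: "av c = 1" "av (d - c * (B - e * A ^ 2)) < 1"
    "poly_iter H p - [:0, 1:] - monom d (p * i + 2) \<in> red_ideal (p * i + 3)"
    using poly_iter_p_expansion[OF A B i e H] by blast
  have less: "av (coeff (poly_iter H p - [:0, 1:]) (p * i + 2) - d) < 1"
    using red_ideal_coeff_less[OF cd(3), of "p * i + 2"] by simp
  have "red_ord (p * i + 2) (poly_iter H p - [:0, 1:]) \<longleftrightarrow> av d = 1"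
  proof
    assume "av d = 1"
    thus "red_ord (p * i + 2) (poly_iter H p - [:0, 1:])"
      using cd(3) unfolding red_ord_def by (intro exI[of _ d]) (simp add: eval_nat_numeral)
  next
    assume "red_ord (p * i + 2) (poly_iter H p - [:0, 1:])"
    hence "av (coeff (poly_iter H p - [:0, 1:]) (p * i + 2)) = 1"
      by (simp only: red_ord_iff)
    thus "av d = 1"
      using less av_eq_if_diff_less by metis
  qed
  also have "av d = 1 \<longleftrightarrow> av (B - e * A ^ 2) = 1"
  proof -
    have "av (c * (B - e * A ^ 2)) = av (B - e * A ^ 2)"
      using cd(1) by (simp add: av_mult)
    moreover have "av (c * (B - e * A ^ 2) - d) < 1"
      using cd(2) by (simp only: av_diff_commute[of _ d])
    ultimately show ?thesis
      using cd(2) av_eq_if_diff_less[of d "c * (B - e * A ^ 2)"]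
        av_eq_if_diff_less[of "c * (B - e * A ^ 2)" d] by auto
  qed
  finally show ?thesis
    unfolding A_def B_def .
qed

theorem red_ord_poly_iter_p_power:
  assumes h0: "red_ord 2 (h - [:0, 1:])"
    and h1: "red_ord (p + 2) (poly_iter h p - [:0, 1:])"
  shows "red_ord (geom n + 1) (poly_iter h (p ^ n) - [:0, 1:])"
proof -
  define a where "a = coeff h 2"
  define b where "b = coeff h 3"
  have h_ideal: "h - [:0, 1:] \<in> red_ideal 2"
    using h0 by (simp add: red_ord_iff)
  have coeffs: "coeff (h - [:0, 1:]) 2 = a" "coeff (h - [:0, 1:]) (2 + 1) = b"
    by (simp_all add: a_def b_def eval_nat_numeral)
  have a: "av a = 1" and b: "av b \<le> 1"
    using h0 red_ideal_coeff_le[OF h_ideal, of "2 + 1"] unfolding red_ord_iff coeffs by auto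
  have h: "h - (monom 1 1 + monom a 2 + monom b 3) \<in> red_ideal 4"
    using red_ideal_split_terms(1)[OF h_ideal, unfolded coeffs]
    by (simp add: X_eq_monom diff_diff_add add_ac eval_nat_numeral)
  have ba: "av (b - a ^ 2) = 1"
    using red_ord_poly_iter_p[of 1 1 h] h0 h1 by (simp add: a_def b_def eval_nat_numeral)

  \<comment> \<open>The induction starts at level 1, which is \<open>h1\<close>: comparing
    coefficients with \<open>h\<close> requires I >= 2.\<close>
  have "red_ord (geom (Suc n) + 1) (poly_iter h (p ^ Suc n) - [:0, 1:])" for n
  proof (induction n)
    case 0
    show ?case
      using h1 by simp
  next
    case (Suc n)
    define H where "H = poly_iter h (p ^ Suc n)"
    define I where "I = geom (Suc n)"
    have I: "2 \<le> I" "[I = 1] (mod p)"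
      using geom_pos[of n] p_ge_3 geom_cong[of "Suc n"] by (auto simp: I_def)
    define A where "A = coeff H (I + 1)"
    define B where "B = coeff H (I + 2)"
    define C where "C = coeff H (I + 3)"
    have ord: "red_ord (I + 1) (H - [:0, 1:])"
      using Suc unfolding H_def I_def .
    have coeffs: "coeff (H - [:0, 1:]) (I + 1) = A" "coeff (H - [:0, 1:]) (I + 1 + 1) = B"
      "coeff (H - [:0, 1:]) (I + 1 + 2) = C"
      using I by (simp_all add: A_def B_def C_def coeff_pCons eval_nat_numeral split: nat.splits)
    have H_ideal: "H - [:0, 1:] \<in> red_ideal (I + 1)" and A: "av A = 1"
      using ord coeffs unfolding red_ord_iff by auto
    have B: "av B \<le> 1" and C: "av C \<le> 1"
      using red_ideal_coeff_le[OF H_ideal, of "I + 1 + 1"] red_ideal_coeff_le[OF H_ideal, of "I + 1 + 2"]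
      unfolding coeffs .
    have H: "H - (monom 1 1 + monom A (I + 1) + monom B (I + 2) + monom C (I + 3)) \<in> red_ideal (I + 4)"
      using red_ideal_split_terms(2)[OF H_ideal, unfolded coeffs]
      by (simp add: X_eq_monom diff_diff_add add_ac eval_nat_numeral)
    have comm: "pcompose H h = pcompose h H"
      unfolding H_def by (metis poly_iter_Suc poly_iter_Suc')
    have less: "av (a * B - A * (b - a ^ 2)) < 1"
      using commuting_second_coefficient[OF _ b h _ B C I H comm] a A by simp
    have "av (A * (b - a ^ 2)) = 1"
      using A ba by (simp add: av_mult)
    hence "av (a * B) = 1"
      using less av_eq_if_diff_less[of "A * (b - a ^ 2)" "a * B"] by (simp add: av_diff_commute)
    hence "av B = 1"
      using a by (simp add: av_mult)
    hence "red_ord (p * I + 2) (poly_iter H p - [:0, 1:])"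
      using red_ord_poly_iter_p[of I 0 H] I ord by (simp add: B_def)
    moreover have "poly_iter H p = poly_iter h (p ^ Suc (Suc n))"
      unfolding H_def by (simp add: mult.commute flip: poly_iter_mult)
    ultimately show ?case
      by (simp add: I_def)
  qed
  thus ?thesis
    using h0 by (cases n) (simp_all add: poly_iter_1 numeral_2_eq_2)
qed

end

section \<open>Multipliers whose reduction has finite order\<close>

locale residue_multiplier = ultrametric_residue_field av p
  for av :: "'a::field \<Rightarrow> real" and p :: nat +
  fixes lam :: 'a and q :: nat
  assumes av_lam: "av lam = 1" and order_q: "residue_order av lam q"
begin

section \<open>Powers of lam and their reductions\<close>

lemma q_pos: "0 < q"
  using order_q by (simp add: residue_order_def)

lemma av_lam_power_less:
  assumes "q dvd m"
  shows "av (lam ^ m - 1) < 1"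
proof -
  have "av (lam ^ q - 1) < 1"
    using order_q by (simp add: residue_order_def)
  thus ?thesis
    using assms av_power_minus_1_less by (auto simp: dvd_def power_mult)
qed

lemma av_lam_power_eq:
  assumes "\<not> q dvd m"
  shows "av (lam ^ m - 1) = 1"
proof -
  define r where "r = m mod q"
  have r: "0 < r" "r < q"
    using assms q_pos by (auto simp: r_def mod_greater_zero_iff_not_dvd)
  have "m = q * (m div q) + r"
    by (simp add: r_def)
  hence eq: "(lam ^ r - 1) - (lam ^ m - 1) = - (lam ^ r * (lam ^ (q * (m div q)) - 1))"
    by (simp add: algebra_simps flip: power_add)
  have "\<not> av (lam ^ r - 1) < 1"
    using r order_q by (simp add: residue_order_def)
  moreover have "av (lam ^ r - 1) \<le> 1"
    using av_lam by (intro av_diff_le av_power_le_1) auto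
  ultimately have "av (lam ^ r - 1) = 1"
    by simp
  moreover have "av (lam ^ r * (lam ^ (q * (m div q)) - 1)) < 1"
    using av_lam by (intro av_mult_less_1' av_lam_power_less av_power_le_1) auto
  ultimately show ?thesis
    using av_eq_if_diff_less[of "lam ^ r - 1" "lam ^ m - 1"] unfolding eq by simp
qed

text \<open>Frobenius is injective on the residue field: if q = r p, then already lam^r reduces to
  1.\<close>

lemma p_not_dvd_q: "\<not> p dvd q"
proof
  assume "p dvd q"
  then obtain r where r: "q = r * p"
    by (auto simp: dvd_def mult.commute)
  hence "0 < r" "r < q"
    using q_pos p_ge_3 by auto
  hence "av (lam ^ r - 1) = 1"
    by (intro av_lam_power_eq) (auto dest: dvd_imp_le)
  hence "av ((lam ^ r - 1) ^ p) = 1"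
    by (simp add: av_power)
  moreover have "av ((lam ^ r - 1) ^ p - (lam ^ q - 1)) < 1"
    using av_power_p_cong[of "lam ^ r"] av_lam by (simp add: r power_mult av_power)
  ultimately have "av (lam ^ q - 1) = 1"
    using av_eq_if_diff_less by metis
  thus False
    using av_lam_power_less[of q] by simp
qed

text \<open>For h = X + w X^(i + 1) + ... the leading term of the difference is q w X^(q + i), and q
  is a unit modulo p.\<close>

lemma red_ord_pcompose_shift:
  assumes y: "y - monom 1 q \<in> red_ideal (Suc q)" and "1 \<le> i"
    and h: "red_ord (Suc i) (h - [:0, 1:])"
  shows "red_ord (q + i) (pcompose y h - y)"
proof -
  obtain w where w: "av w = 1" "h - [:0, 1:] - monom w (i + 1) \<in> red_ideal (i + 2)"
    using h unfolding red_ord_def by auto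
  define R where "R = y - monom 1 q"
  have hX: "h - [:0, 1:] \<in> red_ideal (Suc i)"
    using h by (simp add: red_ord_iff)
  have "pcompose R h - R \<in> red_ideal (q + i + 1)"
    using red_ideal_pcompose_shift[OF y hX] by (simp add: R_def)
  moreover have "h ^ q - monom 1 q - monom (of_nat q * w) (q + i) \<in> red_ideal (q + i + 1)"
    using assms w by (intro power_shift_leading_term) auto
  ultimately have "pcompose R h - R + (h ^ q - monom 1 q - monom (of_nat q * w) (q + i))
      \<in> red_ideal (q + i + 1)"
    by (rule red_ideal_add)
  hence "pcompose y h - y - monom (of_nat q * w) (q + i) \<in> red_ideal (Suc (q + i))"
    by (simp add: R_def pcompose_diff pcompose_monom algebra_simps)
  moreover have "av (of_nat q * w) = 1"
    using w p_not_dvd_q by (simp add: av_mult av_of_nat_eq_1)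
  ultimately show ?thesis
    unfolding red_ord_def by blast
qed

text \<open>Terms of degree \<open>M\<close> not divisible by \<open>q\<close> are removed by changing the coordinate \<open>y\<close>, since then
  \<open>lam ^ M - 1\<close> is a unit; the others are absorbed into \<open>G\<close>.\<close>

lemma semiconjugacy_exists:
  assumes f: "f - monom lam 1 \<in> red_ideal 2"
  shows "\<exists>y G. y - monom 1 q \<in> red_ideal (Suc q) \<and> G - [:0, 1:] \<in> red_ideal 2 \<and>
    pcompose y f - pcompose G y \<in> red_ideal (Suc q + k)"
proof (induction k)
  case 0
  have "f ^ q - monom (lam ^ q) q \<in> red_ideal (Suc q)"
    using power_leading_term[of f lam 1 q] f av_lam by (simp add: numeral_2_eq_2)
  moreover have "monom (lam ^ q - 1) q \<in> red_ideal (Suc q)"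
    by (intro red_ideal_monom_small av_lam_power_less) auto
  ultimately have "f ^ q - monom (lam ^ q) q + monom (lam ^ q - 1) q \<in> red_ideal (Suc q)"
    by (rule red_ideal_add)
  hence "pcompose (monom 1 q) f - pcompose [:0, 1:] (monom 1 q) \<in> red_ideal (Suc q + 0)"
    by (simp add: pcompose_monom pcompose_pCons flip: diff_monom)
  thus ?case
    by (intro exI[of _ "monom 1 q"] exI[of _ "[:0, 1:]"]) auto
next
  case (Suc k)
  then obtain y G where y: "y - monom 1 q \<in> red_ideal (Suc q)" and G: "G - [:0, 1:] \<in> red_ideal 2"
    and D: "pcompose y f - pcompose G y \<in> red_ideal (Suc q + k)"
    by blast
  define M where "M = Suc q + k"
  define e where "e = coeff (pcompose y f - pcompose G y) M"
  have e: "av e \<le> 1"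
    using red_ideal_coeff_le[OF D] by (simp add: e_def)
  have D': "pcompose y f - pcompose G y - monom e M \<in> red_ideal (Suc M)"
    using red_ideal_split[OF D] by (simp add: e_def M_def)
  show ?case
  proof (cases "q dvd M")
    case True
    then obtain s where s: "M = s * q"
      by (auto simp: dvd_def mult.commute)
    \<comment> \<open>Since M > q, the term e X^s added to \<open>G\<close> leaves it tangent to the
      identity.\<close>
    have "2 \<le> s"
    proof (rule ccontr)
      assume "\<not> 2 \<le> s"
      hence "s * q \<le> 1 * q"
        by (intro mult_right_mono) auto
      hence "s * q \<le> q"
        by (simp only: mult_1)
      thus False
        using s unfolding M_def by linarith
    qed
    have "y ^ s - monom 1 M \<in> red_ideal (Suc M)"
      using power_leading_term[OF y, of s] by (simp add: s)
    hence "pcompose y f - pcompose G y - monom e M - smult e (y ^ s - monom 1 M) \<in> red_ideal (Suc M)"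
      by (rule red_ideal_diff[OF D' red_ideal_smult[OF e]])
    hence "pcompose y f - pcompose (G + monom e s) y \<in> red_ideal (Suc q + Suc k)"
      by (simp add: pcompose_add pcompose_monom smult_diff_right smult_monom algebra_simps M_def)
    moreover have "(G - [:0, 1:]) + monom e s \<in> red_ideal 2"
      using e \<open>2 \<le> s\<close> by (intro red_ideal_add G red_ideal_monom)
    ultimately show ?thesis
      using y by (intro exI[of _ y] exI[of _ "G + monom e s"]) (simp add: algebra_simps)
  next
    case False
    \<comment> \<open>Adding m X^M to \<open>y\<close> adds m lam^M X^M to the composite with
      \<open>f\<close> and m X^M to the composite under \<open>G\<close>, up to higher order;
      \<open>m\<close> solves e + m lam^M - m = 0.\<close>
    define m where "m = - e / (lam ^ M - 1)"
    have unit: "av (lam ^ M - 1) = 1"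
      by (rule av_lam_power_eq) fact
    have m: "av m \<le> 1"
      using e unit by (simp add: m_def av_divide)
    have "m * (lam ^ M - 1) = - e"
    proof -
      have "lam ^ M - 1 \<noteq> 0"
        using unit by auto
      thus ?thesis
        by (simp add: m_def)
    qed
    hence em: "e + m * lam ^ M - m = 0"
      by (simp add: algebra_simps)
    have y1: "y \<in> red_ideal 1"
    proof -
      have "y - monom 1 q + monom 1 q \<in> red_ideal 1"
        using q_pos by (intro red_ideal_add red_ideal_monom red_ideal_mono[OF y]) auto
      thus ?thesis
        by simp
    qed
    have "f ^ M - monom (lam ^ M) M \<in> red_ideal (Suc M)"
      using power_leading_term[of f lam 1 M] f av_lam by (simp add: numeral_2_eq_2)
    hence 1: "smult m (f ^ M - monom (lam ^ M) M) \<in> red_ideal (Suc M)"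
      by (intro red_ideal_smult m)
    have "monom m M \<in> red_ideal (Suc (q + k))"
      using m by (intro red_ideal_monom) (auto simp: M_def)
    hence 2: "pcompose (G - [:0, 1:]) (y + monom m M) - pcompose (G - [:0, 1:]) y \<in> red_ideal (Suc M)"
      using red_ideal_pcompose_diff[OF G y1] by (simp add: M_def)
    define y' where "y' = y + monom m M"
    have "pcompose y' f - pcompose G y' =
        (pcompose y f - pcompose G y - monom e M) + smult m (f ^ M - monom (lam ^ M) M)
        - (pcompose (G - [:0, 1:]) (y + monom m M) - pcompose (G - [:0, 1:]) y)
        + monom (e + m * lam ^ M - m) M"
      by (simp add: y'_def pcompose_add pcompose_diff pcompose_monom pcompose_pCons smult_diff_right
          smult_monom algebra_simps flip: add_monom diff_monom)
    also have "\<dots> \<in> red_ideal (Suc M)"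
      unfolding em monom_eq_0 using D' 1 2 by (rule red_ideal_add[OF red_ideal_diff[OF red_ideal_add] red_ideal_0])
    finally have "pcompose y' f - pcompose G y' \<in> red_ideal (Suc q + Suc k)"
      by (simp add: M_def)
    moreover have "y - monom 1 q + monom m M \<in> red_ideal (Suc q)"
      using m by (intro red_ideal_add y red_ideal_monom) (auto simp: M_def)
    hence "y' - monom 1 q \<in> red_ideal (Suc q)"
      by (simp add: y'_def algebra_simps)
    ultimately show ?thesis
      using G by blast
  qed
qed

text \<open>The series G^m(y) - y has order d q when seen as (G^m - X) at y, and order q + i when
  seen as y(f^m) - y. So G^m has ramification number d - 1 = i / q. The bound \<open>K\<close> keeps
  q + i within the precision of the semiconjugacy.\<close>

lemma semiconjugate_ramification:
  assumes f: "f - monom lam 1 \<in> red_ideal 2"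
  obtains G where "\<And>m i. 1 \<le> i \<Longrightarrow> i \<le> K \<Longrightarrow> red_ord (Suc i) (poly_iter f m - [:0, 1:]) \<Longrightarrow>
    \<exists>d. red_ord d (poly_iter G m - [:0, 1:]) \<and> d * q = q + i"
proof -
  obtain y G where y: "y - monom 1 q \<in> red_ideal (Suc q)" and G: "G - [:0, 1:] \<in> red_ideal 2"
    and D: "pcompose y f - pcompose G y \<in> red_ideal (Suc (q + K))"
    using semiconjugacy_exists[OF f, of K] by auto
  have y_ord: "red_ord q y"
    using y unfolding red_ord_def by (metis av_1)
  have y1: "y \<in> red_ideal 1"
    using y_ord q_pos red_ideal_mono by (auto simp: red_ord_iff Suc_le_eq)
  have "G - [:0, 1:] + [:0, 1:] \<in> red_ideal 1"
    by (intro red_ideal_add red_ideal_X red_ideal_mono[OF G]) auto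
  hence G1: "G \<in> red_ideal 1"
    by simp
  have "f - monom lam 1 + monom lam 1 \<in> red_ideal 1"
    using av_lam by (intro red_ideal_add red_ideal_monom red_ideal_mono[OF f]) auto
  hence f1: "f \<in> red_ideal 1"
    by simp
  have "\<exists>d. red_ord d (poly_iter G m - [:0, 1:]) \<and> d * q = q + i"
    if i: "1 \<le> i" "i \<le> K" and ord: "red_ord (Suc i) (poly_iter f m - [:0, 1:])" for m i
  proof -
    define E where "E = poly_iter G m - [:0, 1:]"
    have "pcompose y (poly_iter f m) - pcompose (poly_iter G m) y \<in> red_ideal (Suc (q + K))"
      by (intro semiconjugacy_iter f1 y1 G1 D)
    hence "- (pcompose y (poly_iter f m) - pcompose (poly_iter G m) y) \<in> red_ideal (Suc (q + K))"
      by (simp only: red_ideal_minus_iff)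
    moreover have "- (pcompose y (poly_iter f m) - pcompose (poly_iter G m) y) =
        pcompose E y - (pcompose y (poly_iter f m) - y)"
      by (simp add: E_def pcompose_diff pcompose_pCons)
    ultimately have "pcompose E y - (pcompose y (poly_iter f m) - y) \<in> red_ideal (Suc (q + K))"
      by (simp only:)
    hence Ey: "red_ord (q + i) (pcompose E y)"
      using i by (intro red_ord_cong[OF red_ord_pcompose_shift[OF y i(1) ord]]) auto
    have E0: "E \<in> red_ideal 0"
      unfolding E_def
      by (intro red_ideal_diff red_ideal_mono[OF poly_iter_in_red_ideal_1[OF G1]] red_ideal_mono[OF red_ideal_X]) auto
    \<comment> \<open>This excludes a zero reduction of \<open>E\<close>, so that \<open>E\<close>
      has an order at all.\<close>
    have "E \<notin> red_ideal (Suc (q + i))"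
    proof
      assume "E \<in> red_ideal (Suc (q + i))"
      hence "pcompose E y \<in> red_ideal (Suc (q + i) * 1)"
        using y1 by (intro red_ideal_pcompose)
      thus False
        using red_ord_not_ideal[OF Ey, of "Suc (q + i)"] by simp
    qed
    then obtain d where d: "red_ord d E"
      using red_ord_or_ideal[OF E0] by blast
    hence "red_ord (d * q) (pcompose E y)"
      using y_ord q_pos by (intro red_ord_pcompose)
    thus ?thesis
      using d Ey red_ord_unique unfolding E_def by blast
  qed
  thus ?thesis
    using that by blast
qed

lemma ramification_dvd:
  assumes "f - monom lam 1 \<in> red_ideal 2" "1 \<le> i" "red_ord (Suc i) (poly_iter f m - [:0, 1:])"
  shows "q dvd i"
proof -
  obtain d where "d * q = q + i"
    using semiconjugate_ramification[OF assms(1), of i] assms(2,3) by (metis order_refl)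
  thus ?thesis
    by (metis dvd_add_right_iff dvd_refl dvd_triv_right)
qed

lemma minimally_ramified_from_first:
  assumes f: "f - monom lam 1 \<in> red_ideal 2"
    and i: "\<And>n. red_ord (Suc (i n)) (poly_iter f (q * p ^ n) - [:0, 1:])" "\<And>n. 1 \<le> i n"
    and "i 0 = q" "i (Suc 0) = q * (p + 1)"
  shows "i n = q * geom n"
proof -
  \<comment> \<open>A single \<open>G\<close> must be precise enough for the levels 0, 1 and n at
    once.\<close>
  define K where "K = Max {i 0, i 1, i n}"
  obtain G where G: "\<And>m i. 1 \<le> i \<Longrightarrow> i \<le> K \<Longrightarrow> red_ord (Suc i) (poly_iter f m - [:0, 1:]) \<Longrightarrow>
      \<exists>d. red_ord d (poly_iter G m - [:0, 1:]) \<and> d * q = q + i"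
    using semiconjugate_ramification[OF f, of K] by blast
  define h where "h = poly_iter G q"
  have h: "\<exists>d. red_ord d (poly_iter h (p ^ m) - [:0, 1:]) \<and> d * q = q + i m" if "i m \<le> K" for m
    using G[OF i(2) that i(1)] unfolding h_def poly_iter_mult by blast
  obtain d0 where d0: "red_ord d0 (poly_iter h (p ^ 0) - [:0, 1:])" "d0 * q = q + i 0"
    using h[of 0] by (auto simp: K_def)
  obtain d1 where d1: "red_ord d1 (poly_iter h (p ^ 1) - [:0, 1:])" "d1 * q = q + i 1"
    using h[of 1] by (auto simp: K_def le_max_iff_disj)
  obtain d where d: "red_ord d (poly_iter h (p ^ n) - [:0, 1:])" "d * q = q + i n"
    using h[of n] by (auto simp: K_def le_max_iff_disj)
  have "d0 * q = 2 * q" "d1 * q = (p + 2) * q"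
    using d0 d1 assms by (auto simp: algebra_simps)
  hence "d0 = 2" "d1 = p + 2"
    using q_pos mult_right_cancel[of q] by (metis less_irrefl)+
  hence "red_ord (geom n + 1) (poly_iter h (p ^ n) - [:0, 1:])"
    using d0 d1 by (intro red_ord_poly_iter_p_power) (auto simp: poly_iter_1)
  hence "d = geom n + 1"
    using d red_ord_unique by blast
  thus ?thesis
    using d by (simp add: algebra_simps)
qed

text \<open>A relation lam^m = 1 forces m = q r. If p divides r, injectivity of Frobenius gives a
  smaller relation; otherwise, with x = lam^q, the factor 1 + x + ... + x^(r-1) reduces to r, a
  unit, so x = 1.\<close>

lemma not_root_of_unity_char_p:
  assumes char: "of_nat p = (0 :: 'a)" and q: "lam ^ q \<noteq> 1"
  shows "0 < m \<Longrightarrow> lam ^ m \<noteq> 1"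
proof (induction m rule: less_induct)
  case (less m)
  show ?case
  proof
    assume eq: "lam ^ m = 1"
    hence "q dvd m"
      using av_lam_power_eq[of m] by fastforce
    then obtain r where r: "m = q * r"
      by blast
    show False
    proof (cases "p dvd r")
      case True
      then obtain r' where r': "r = r' * p"
        by (auto simp: dvd_def mult.commute)
      define x where "x = lam ^ (q * r')"
      have "x ^ p = (\<Sum>k\<le>p. of_nat (p choose k) * (x - 1) ^ k)"
        using binomial_ring[of "x - 1" 1 p] by simp
      also have "\<dots> = 1 + (x - 1) ^ p + (\<Sum>k\<in>{0<..<p}. of_nat (p choose k) * (x - 1) ^ k)"
        by (subst sum_binomial_p) simp
      also have "(\<Sum>k\<in>{0<..<p}. of_nat (p choose k) * (x - 1) ^ k) = 0"
      proof (rule sum.neutral, rule ballI)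
        fix k assume "k \<in> {0<..<p}"
        hence "p dvd (p choose k)"
          using prime_p by (intro dvd_choose_prime) auto
        thus "of_nat (p choose k) * (x - 1) ^ k = 0"
          using char by (auto simp: dvd_def)
      qed
      finally have "x ^ p = 1 + (x - 1) ^ p"
        by simp
      moreover have "x ^ p = 1"
        using eq by (simp add: x_def r r' power_mult)
      ultimately have "x = 1"
        by simp
      moreover have "0 < q * r'" "q * r' < m"
        using less.prems p_ge_3 by (auto simp: r r')
      ultimately show False
        using less.IH unfolding x_def by blast
    next
      case False
      define x where "x = lam ^ q"
      have x: "av (x - 1) < 1"
        by (simp add: x_def av_lam_power_less)
      have "x ^ r - 1 = (x - 1) * (\<Sum>i<r. x ^ i)"
        by (rule power_diff_1_eq)
      moreover have "x ^ r = 1"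
        using eq by (simp add: x_def r power_mult)
      ultimately have "(\<Sum>i<r. x ^ i) = 0"
        using q by (simp add: x_def)
      thus False
        using av_sum_powers[OF x, of r] av_of_nat_eq_1[OF False] by simp
    qed
  qed
qed

text \<open>Integers prime to p have absolute value 1, so a vanishing m is a multiple of p; removing
  factors p ends with p itself vanishing.\<close>

lemma char_p:
  assumes "0 < m" "of_nat m = (0 :: 'a)"
  shows "of_nat p = (0 :: 'a)"
  using assms
proof (induction m rule: less_induct)
  case (less m)
  have "p dvd m"
    using less.prems av_of_nat_eq_1[of m] by fastforce
  then obtain m' where m': "m = p * m'"
    by blast
  show ?case
  proof (cases "of_nat m' = (0 :: 'a)")
    case True
    have "m' < m"
      using less.prems m' p_ge_3 n_less_m_mult_n[of m' p] by auto
    thus ?thesis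
      using True less.IH[of m'] less.prems m' by auto
  next
    case False
    thus ?thesis
      using less.prems m' by simp
  qed
qed

end

section \<open>Cycles of quadratic polynomials in the open unit disc\<close>

text \<open>\<open>simple\<close> is the only trace of the genericity of lam from here on: periodic
  points have multiplier other than 1.\<close>

locale quadratic_dynamics = residue_multiplier +
  assumes alg_closed: "alg_closed_field TYPE('a)"
    and simple: "\<And>m z. 0 < m \<Longrightarrow> (quad_map lam ^^ m) z = z \<Longrightarrow>
      (\<Prod>i<m. lam + 2 * (quad_map lam ^^ i) z) \<noteq> 1"
begin

abbreviation "f \<equiv> quad_map lam"

section \<open>Fixed points of the iterates in the open unit disc\<close>

definition fix_poly :: "nat \<Rightarrow> 'a poly" where
  "fix_poly m = poly_iter (quad_poly lam) m - [:0, 1:]"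

definition fix_points :: "nat \<Rightarrow> 'a set" where
  "fix_points m = {z. av z < 1 \<and> (f ^^ m) z = z}"

lemma poly_quad_poly: "poly (quad_poly lam) = f"
  by (rule ext) (simp add: quad_poly_def quad_map_def algebra_simps power2_eq_square)

lemma poly_fix_poly: "poly (fix_poly m) z = (f ^^ m) z - z"
  by (simp add: fix_poly_def poly_poly_iter poly_quad_poly)

lemma poly_pderiv_iter:
  "poly (pderiv (poly_iter (quad_poly lam) m)) z = (\<Prod>i<m. lam + 2 * (f ^^ i) z)"
proof (induction m)
  case (Suc m)
  have "poly (pderiv (quad_poly lam)) w = lam + 2 * w" for w
    by (simp add: quad_poly_def pderiv_pCons algebra_simps)
  thus ?case
    using Suc by (simp add: poly_iter_Suc pderiv_pcompose poly_pcompose poly_poly_iter poly_quad_poly mult.commute)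
qed (simp add: poly_iter_0 pderiv_pCons)

lemma poly_pderiv_fix_poly: "poly (pderiv (fix_poly m)) z = (\<Prod>i<m. lam + 2 * (f ^^ i) z) - 1"
  by (simp add: fix_poly_def pderiv_diff poly_pderiv_iter pderiv_pCons)

lemma funpow_0_fixed [simp]: "(f ^^ m) 0 = 0"
  by (induction m) (auto simp: quad_map_def)

lemma lam_power_neq_1: "0 < m \<Longrightarrow> lam ^ m \<noteq> 1"
  using simple[of m 0] by simp

lemma degree_iter: "degree (poly_iter (quad_poly lam) m) = 2 ^ m"
  and lead_coeff_iter: "lead_coeff (poly_iter (quad_poly lam) m) = 1"
proof -
  have "degree (poly_iter (quad_poly lam) m) = 2 ^ m \<and> lead_coeff (poly_iter (quad_poly lam) m) = 1"
  proof (induction m)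
    case (Suc m)
    have "degree (quad_poly lam) = 2" "lead_coeff (quad_poly lam) = 1"
      by (simp_all add: quad_poly_def)
    moreover have "lead_coeff (poly_iter (quad_poly lam) (Suc m)) =
        lead_coeff (quad_poly lam) * lead_coeff (poly_iter (quad_poly lam) m) ^ degree (quad_poly lam)"
      unfolding poly_iter_Suc by (rule lead_coeff_comp) (simp add: Suc)
    ultimately have "lead_coeff (poly_iter (quad_poly lam) (Suc m)) = 1"
      using conjunct2[OF Suc] by (simp only: power_one mult_1)
    moreover have "degree (poly_iter (quad_poly lam) (Suc m)) = 2 ^ Suc m"
      using Suc \<open>degree (quad_poly lam) = 2\<close> by (simp add: poly_iter_Suc degree_pcompose)
    ultimately show ?case
      by blast
  qed (simp add: poly_iter_0)
  thus "degree (poly_iter (quad_poly lam) m) = 2 ^ m" "lead_coeff (poly_iter (quad_poly lam) m) = 1"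
    by auto
qed

lemma lead_coeff_fix_poly:
  assumes "0 < m"
  shows "lead_coeff (fix_poly m) = 1"
proof -
  have "degree (- [:0, 1:] :: 'a poly) < degree (poly_iter (quad_poly lam) m)"
    using assms one_less_power[of "2 :: nat" m] by (simp add: degree_iter)
  hence "lead_coeff (poly_iter (quad_poly lam) m + - [:0, 1:]) = lead_coeff (poly_iter (quad_poly lam) m)"
    using lead_coeff_add_le[of "- [:0, 1:]" "poly_iter (quad_poly lam) m"] by (simp only: add.commute)
  thus ?thesis
    by (simp only: fix_poly_def diff_conv_add_uminus lead_coeff_iter)
qed

lemma quad_poly_red: "quad_poly lam - monom lam 1 \<in> red_ideal 2"
proof -
  have "quad_poly lam - monom lam 1 = monom 1 2"
    by (simp add: quad_poly_def monom_Suc monom_0 numeral_2_eq_2)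
  thus ?thesis
    by (simp add: red_ideal_monom)
qed

lemma quad_poly_red_1: "quad_poly lam \<in> red_ideal 1"
proof -
  have "quad_poly lam - monom lam 1 + monom lam 1 \<in> red_ideal 1"
    using av_lam by (intro red_ideal_add red_ideal_mono[OF quad_poly_red] red_ideal_monom) auto
  thus ?thesis
    by simp
qed

lemma fix_poly_red: "fix_poly m \<in> red_ideal 0"
  unfolding fix_poly_def
  by (intro red_ideal_diff red_ideal_mono[OF poly_iter_in_red_ideal_1[OF quad_poly_red_1]]
      red_ideal_mono[OF red_ideal_X]) auto

lemma fix_poly_eq_prod:
  assumes "0 < m"
  shows "fix_poly m = (\<Prod>x\<in>{x. poly (fix_poly m) x = 0}. [:- x, 1:])"
  using assms simple
  by (intro monic_splits_distinct alg_closed lead_coeff_fix_poly) (auto simp: poly_fix_poly poly_pderiv_fix_poly)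

lemma fix_poly_roots:
  assumes "0 < m"
  shows "finite {x. poly (fix_poly m) x = 0}"
    and "poly (fix_poly m) x = 0 \<Longrightarrow> av x \<le> 1"
proof -
  have "fix_poly m \<noteq> 0"
    using lead_coeff_fix_poly[OF assms] by auto
  thus "finite {x. poly (fix_poly m) x = 0}"
    by (rule poly_roots_finite)
  show "poly (fix_poly m) x = 0 \<Longrightarrow> av x \<le> 1"
    by (rule monic_root_le_1[OF lead_coeff_fix_poly[OF assms] fix_poly_red])
qed

lemma fix_points_eq: "fix_points m = {x \<in> {x. poly (fix_poly m) x = 0}. av x < 1}"
  by (auto simp: fix_points_def poly_fix_poly)

lemma finite_fix_points: "0 < m \<Longrightarrow> finite (fix_points m)"
  using fix_poly_roots(1) unfolding fix_points_eq by simp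

lemma zero_fix_point [simp]: "0 \<in> fix_points m"
  by (simp add: fix_points_def)

lemma card_fix_points_pos: "0 < m \<Longrightarrow> 0 < card (fix_points m)"
  using finite_fix_points zero_fix_point by (metis card_gt_0_iff empty_iff)

lemma red_ord_fix_poly:
  assumes "0 < m"
  shows "red_ord (card (fix_points m)) (fix_poly m)"
  unfolding fix_points_eq
  by (subst (2) fix_poly_eq_prod[OF assms]) (rule red_ord_prod_roots, use fix_poly_roots[OF assms] in auto)

text \<open>Both sides come from the derivative of \<open>fix_poly m\<close> at 0, computed once
  from the dynamics and once from the factorisation; roots outside the open disc have absolute value
  1.\<close>

lemma prod_fix_points:
  assumes "0 < m"
  shows "(\<Prod>x\<in>fix_points m - {0}. av x) = av (lam ^ m - 1)"
proof -
  define R where "R = {x. poly (fix_poly m) x = 0}"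
  have R: "finite R" "0 \<in> R" "\<And>x. x \<in> R \<Longrightarrow> av x \<le> 1"
    using fix_poly_roots[OF assms] by (auto simp: R_def poly_fix_poly)
  have "fix_poly m = [:0, 1:] * (\<Prod>x\<in>R - {0}. [:- x, 1:])"
    using fix_poly_eq_prod[OF assms] prod.remove[OF R(1,2), of "\<lambda>x. [:- x, 1:]"]
    unfolding R_def by simp
  hence "poly (pderiv (fix_poly m)) 0 = (\<Prod>x\<in>R - {0}. - x)"
    by (simp add: pderiv_mult pderiv_pCons poly_prod del: mult_pCons_left)
  hence "lam ^ m - 1 = (\<Prod>x\<in>R - {0}. - x)"
    by (simp add: poly_pderiv_fix_poly)
  hence "av (lam ^ m - 1) = (\<Prod>x\<in>R - {0}. av x)"
    by (simp add: av_prod)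
  also have "\<dots> = (\<Prod>x\<in>fix_points m - {0}. av x)"
    using R by (intro prod.mono_neutral_right) (force simp: fix_points_eq R_def)+
  finally show ?thesis
    by simp
qed

lemma av_f: "av z < 1 \<Longrightarrow> av (f z) = av z"
proof (cases "z = 0")
  case False
  assume "av z < 1"
  have "av (z ^ 2) = av z * av z"
    by (simp add: av_mult power2_eq_square)
  also have "\<dots> < av z * 1"
    using \<open>av z < 1\<close> False by (intro mult_strict_left_mono) (auto simp: order.strict_iff_order)
  finally have "av (z ^ 2) < av (lam * z)"
    by (simp add: av_mult av_lam)
  hence "av (lam * z - f z) < av (lam * z)"
    by (simp add: quad_map_def)
  from av_eq_if_diff_less[OF this] show ?thesis
    by (simp add: av_mult av_lam)
qed (simp add: quad_map_def)

lemma av_funpow: "av z < 1 \<Longrightarrow> av ((f ^^ k) z) = av z"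
  by (induction k) (auto simp: av_f)

text \<open>The nonzero fixed points have absolute values below 1 but product |lam^m - 1| =
  1.\<close>

lemma fix_points_trivial:
  assumes "0 < m" "\<not> q dvd m"
  shows "fix_points m = {0}"
proof (rule ccontr)
  assume "fix_points m \<noteq> {0}"
  hence "fix_points m - {0} \<noteq> {}"
    using zero_fix_point by blast
  hence "(\<Prod>x\<in>fix_points m - {0}. av x) < 1"
    using finite_fix_points[OF assms(1)] by (intro prod_less_1) (auto simp: fix_points_def)
  thus False
    using prod_fix_points[OF assms(1)] av_lam_power_eq[OF assms(2)] by simp
qed

text \<open>The points whose period is a proper divisor of q p^n. For n = 0 only the origin is left,
  since nonzero periodic points in the disc have period divisible by q.\<close>

definition lower_points :: "nat \<Rightarrow> 'a set" where
  "lower_points n = (case n of 0 \<Rightarrow> {0} | Suc k \<Rightarrow> fix_points (q * p ^ k))"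

definition new_points :: "nat \<Rightarrow> 'a set" where
  "new_points n = fix_points (q * p ^ n) - lower_points n"

lemma qp_pos: "0 < q * p ^ n"
  using q_pos p_ge_3 by simp

lemma lower_points_subset: "lower_points n \<subseteq> fix_points (q * p ^ n)" "0 \<in> lower_points n"
proof -
  show "0 \<in> lower_points n"
    by (auto simp: lower_points_def split: nat.splits)
  show "lower_points n \<subseteq> fix_points (q * p ^ n)"
  proof (cases n)
    case (Suc k)
    show ?thesis
      unfolding Suc lower_points_def
      by (auto simp: fix_points_def intro: funpow_fixed_dvd[where d = "q * p ^ k"])
  qed (auto simp: lower_points_def)
qed

text \<open>By \<open>fix_points_trivial\<close> the minimal period is a multiple of q, so it is q
  p^k, and k < n would make \<open>z\<close> a lower point.\<close>

lemma new_points_min_period: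
  assumes "z \<in> new_points n"
  shows "min_period f z (q * p ^ n)"
proof -
  have z: "av z < 1" "(f ^^ (q * p ^ n)) z = z" "z \<notin> lower_points n"
    using assms by (auto simp: new_points_def fix_points_def)
  obtain d where d: "min_period f z d" "d dvd q * p ^ n"
    using min_period_exists[OF qp_pos z(2)] by blast
  have "z \<noteq> 0"
    using z(3) lower_points_subset(2) by blast
  hence "q dvd d"
    using d(1) z(1) fix_points_trivial[of d] by (auto simp: min_period_def fix_points_def)
  then obtain e where e: "d = q * e"
    by blast
  hence "e dvd p ^ n"
    using d(2) q_pos by simp
  then obtain k where k: "k \<le> n" "e = p ^ k"
    using prime_p divides_primepow_nat by blast
  have "k = n"
  proof (rule ccontr)
    assume "k \<noteq> n"
    then obtain m where m: "n = Suc m" "k \<le> m"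
      using k(1) by (cases n) auto
    have "d dvd q * p ^ m"
      using m by (simp add: e k le_imp_power_dvd)
    hence "z \<in> lower_points n"
      using d(1) z(1) funpow_fixed_dvd[where d = d]
      by (auto simp: m lower_points_def fix_points_def min_period_def)
    thus False
      using z(3) by blast
  qed
  thus ?thesis
    using d(1) e k by simp
qed

lemma min_period_new_points:
  assumes "av z < 1" "min_period f z (q * p ^ n)" "1 \<le> n"
  shows "z \<in> new_points n"
proof -
  obtain k where k: "n = Suc k"
    using assms(3) by (cases n) auto
  have "q * p ^ k < q * p ^ n"
    using q_pos p_ge_3 by (simp add: k)
  thus ?thesis
    using assms(1,2) qp_pos[of k]
    by (auto simp: new_points_def lower_points_def fix_points_def min_period_def k)
qed

lemma orbit_subset_new_points:
  assumes "z \<in> new_points n"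
  shows "orbit f z \<subseteq> new_points n"
proof
  fix w assume "w \<in> orbit f z"
  then obtain k where k: "k < q * p ^ n" "w = (f ^^ k) z"
    using card_orbit(1)[OF new_points_min_period[OF assms]] by auto
  have z: "av z < 1" "(f ^^ (q * p ^ n)) z = z" "z \<notin> lower_points n"
    using assms by (auto simp: new_points_def fix_points_def)
  have w: "av w < 1"
    using z av_funpow by (simp add: k)
  have comm: "(f ^^ a) ((f ^^ b) x) = (f ^^ b) ((f ^^ a) x)" for a b x
    by (metis add.commute comp_apply funpow_add)
  have return: "(f ^^ (q * p ^ n - k)) w = z"
    using k z by (metis comp_apply funpow_add le_add_diff_inverse2 less_imp_le)
  have "w \<in> fix_points (q * p ^ n)"
    using w z by (simp add: fix_points_def k comm[of "q * p ^ n"])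
  moreover have "w \<notin> lower_points n"
  proof
    assume low: "w \<in> lower_points n"
    have "z \<in> lower_points n"
    proof (cases n)
      case 0
      thus ?thesis
        using low return by (auto simp: lower_points_def)
    next
      case (Suc m)
      thus ?thesis
        using low z(1) comm[of "q * p ^ m" "q * p ^ n - k" w] return
        by (auto simp: lower_points_def fix_points_def)
    qed
    thus False
      using z(3) by blast
  qed
  ultimately show "w \<in> new_points n"
    by (simp add: new_points_def)
qed

lemma finite_new_points: "finite (new_points n)"
  using finite_fix_points[OF qp_pos] by (simp add: new_points_def)

lemma prod_new_points:
  "(\<Prod>x\<in>new_points n. av x) =
     (case n of 0 \<Rightarrow> av (lam ^ q - 1) | Suc k \<Rightarrow> av ((lam ^ (q * p ^ n) - 1) / (lam ^ (q * p ^ k) - 1)))"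
proof (cases n)
  case 0
  thus ?thesis
    using prod_fix_points[OF q_pos] by (simp add: new_points_def lower_points_def)
next
  case (Suc k)
  have eq: "fix_points (q * p ^ n) - {0} = new_points n \<union> (fix_points (q * p ^ k) - {0})"
    "new_points n \<inter> (fix_points (q * p ^ k) - {0}) = {}"
    using lower_points_subset[of n] by (auto simp: new_points_def Suc lower_points_def)
  have "av (lam ^ (q * p ^ n) - 1) = (\<Prod>x\<in>new_points n. av x) * av (lam ^ (q * p ^ k) - 1)"
    unfolding prod_fix_points[OF qp_pos, symmetric] eq(1)
    by (rule prod.union_disjoint[OF finite_new_points _ eq(2)]) (use finite_fix_points[OF qp_pos] in blast)
  moreover have "lam ^ (q * p ^ k) - 1 \<noteq> 0"
    using lam_power_neq_1[OF qp_pos] by simp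
  ultimately show ?thesis
    by (simp add: Suc av_divide field_simps)
qed

text \<open>The product of absolute values is below 1, hence not empty: with x = lam^(q p^k) the
  quotient is 1 + x + ... + x^(p-1), which reduces to p = 0.\<close>

lemma new_points_nonempty: "new_points n \<noteq> {}"
proof
  assume "new_points n = {}"
  hence prod: "(\<Prod>x\<in>new_points n. av x) = 1"
    by simp
  show False
  proof (cases n)
    case 0
    thus ?thesis
      using prod prod_new_points[of n] av_lam_power_less[of q] by simp
  next
    case (Suc k)
    define x where "x = lam ^ (q * p ^ k)"
    have x: "av (x - 1) < 1" "x \<noteq> 1"
      using av_lam_power_less lam_power_neq_1[OF qp_pos] by (auto simp: x_def)
    have "lam ^ (q * p ^ n) = x ^ p"
      by (simp add: x_def Suc mult_ac flip: power_mult)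
    hence "(lam ^ (q * p ^ n) - 1) / (x - 1) = (\<Sum>i<p. x ^ i)"
      using x(2) by (simp add: power_diff_1_eq)
    moreover have "av ((\<Sum>i<p. x ^ i) - of_nat p + of_nat p) < 1"
      by (intro av_add_less av_sum_powers x av_p)
    ultimately show ?thesis
      using prod prod_new_points[of n] by (simp add: Suc x_def)
  qed
qed

lemma card_new_points_ge: "q * p ^ n \<le> card (new_points n)"
proof -
  obtain z where z: "z \<in> new_points n"
    using new_points_nonempty by blast
  show ?thesis
    using card_mono[OF finite_new_points orbit_subset_new_points[OF z]]
      card_orbit(2)[OF new_points_min_period[OF z]] by simp
qed

lemma orbit_eq_new_points:
  assumes "card (new_points n) = q * p ^ n" "z \<in> new_points n"
  shows "orbit f z = new_points n"
  using assms card_orbit(2)[OF new_points_min_period[OF assms(2)]]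
  by (intro card_subset_eq finite_new_points orbit_subset_new_points) auto

text \<open>The ramification number i_n of the reduction of the q-th iterate; the origin, removed
  from the count, corresponds to the division by zeta.\<close>

definition ram :: "nat \<Rightarrow> nat" where
  "ram n = card (fix_points (q * p ^ n)) - 1"

lemma red_ord_ram: "red_ord (Suc (ram n)) (poly_iter (quad_poly lam) (q * p ^ n) - [:0, 1:])"
  using red_ord_fix_poly[OF qp_pos, of n] card_fix_points_pos[OF qp_pos, of n]
  by (simp add: ram_def fix_poly_def)

lemma card_new_points: "card (new_points n) = (case n of 0 \<Rightarrow> ram 0 | Suc k \<Rightarrow> ram n - ram k)"
  and ram_Suc: "ram (Suc k) = ram k + card (new_points (Suc k))"
proof -
  have card: "card (fix_points (q * p ^ n)) = card (new_points n) + card (lower_points n)" for n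
    unfolding new_points_def
    using card_Diff_subset[OF _ lower_points_subset(1)] lower_points_subset(1)[of n]
      finite_fix_points[OF qp_pos, of n] by (metis card_mono finite_subset le_add_diff_inverse2)
  show Suc: "ram (Suc k) = ram k + card (new_points (Suc k))" for k
    using card[of "Suc k"] card_fix_points_pos[OF qp_pos, of k] by (simp add: ram_def lower_points_def)
  show "card (new_points n) = (case n of 0 \<Rightarrow> ram 0 | Suc k \<Rightarrow> ram n - ram k)"
    using card[of 0] Suc by (auto simp: ram_def lower_points_def split: nat.splits)
qed

lemma ram_ge: "q * geom n \<le> ram n"
proof (induction n)
  case 0
  show ?case
    using card_new_points_ge[of 0] card_new_points[of 0] by simp
next
  case (Suc n)
  show ?case
    using Suc card_new_points_ge[of "Suc n"] unfolding ram_Suc geom_Suc' add_mult_distrib2 by linarith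
qed

lemma ram_pos: "1 \<le> ram n"
proof -
  have "1 * 1 \<le> q * geom n"
    using q_pos geom_pos by (intro mult_le_mono) auto
  thus ?thesis
    using ram_ge[of n] by linarith
qed

lemma red_minimally_ramified_iff:
  "red_minimally_ramified av p q (quad_poly lam) \<longleftrightarrow> (\<forall>n. ram n = q * geom n)"
proof -
  have "red_i av p (poly_iter (quad_poly lam) q) n = Some (ram n)" for n
  proof -
    define h where "h = poly_iter (quad_poly lam) (q * p ^ n)"
    have 1: "av (coeff (h - [:0, 1:]) (Suc (ram n))) = 1"
      and 2: "\<And>j. j < ram n \<Longrightarrow> av (coeff (h - [:0, 1:]) (Suc j)) < 1"
      using red_ord_ram[of n] unfolding h_def [symmetric] red_ord_iff red_ideal_def by auto
    have "(LEAST j. 1 \<le> av (coeff (h - [:0, 1:]) (Suc j))) = ram n"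
    proof (rule Least_equality)
      fix j assume "1 \<le> av (coeff (h - [:0, 1:]) (Suc j))"
      thus "ram n \<le> j"
        using 2[of j] by (meson not_le)
    qed (use 1 in simp)
    moreover have "\<exists>j. 1 \<le> av (coeff (h - [:0, 1:]) (Suc j))"
      using 1 by (intro exI[of _ "ram n"]) simp
    ultimately have "red_ord_shift av h = Some (ram n)"
      by (simp only: red_ord_shift_def if_True)
    thus ?thesis
      by (simp add: red_i_def h_def poly_iter_mult)
  qed
  thus ?thesis
    by (simp add: red_minimally_ramified_def geom_eq)
qed

text \<open>Each level contributes at least one full cycle, so a total without excess has no excess
  at any lower level.\<close>

lemma ram_eq_downward:
  assumes "ram n = q * geom n" "k \<le> n"
  shows "ram k = q * geom k"
  using assms(2,1)
proof (induction rule: inc_induct)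
  case (step k)
  hence "ram k + card (new_points (Suc k)) = q * geom k + q * p ^ Suc k"
    using ram_Suc[of k] unfolding geom_Suc' by (simp add: add_mult_distrib2)
  thus ?case
    using card_new_points_ge[of "Suc k"] ram_ge[of k] by linarith
qed

lemma ram_Suc_ge: "p * ram n \<le> ram (Suc n)"
proof (rule ccontr)
  assume less: "\<not> p * ram n \<le> ram (Suc n)"
  have "poly_iter (poly_iter (quad_poly lam) (q * p ^ n)) p - [:0, 1:] \<in> red_ideal (Suc (p * ram n))"
    using red_ord_ram[of n] by (intro poly_iter_p_in) (simp add: red_ord_iff)
  hence "poly_iter (quad_poly lam) (q * p ^ Suc n) - [:0, 1:] \<in> red_ideal (Suc (p * ram n))"
    by (simp add: mult_ac flip: poly_iter_mult)
  thus False
    using red_ord_not_ideal[OF red_ord_ram[of "Suc n"], of "Suc (p * ram n)"] less by simp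
qed

text \<open>Write i_(n-1) = q j. Then (p - 1) j <= p^n = (p - 1) geom (n - 1) + 1, and p - 1 >= 2
  leaves no integer j above geom (n - 1).\<close>

lemma minimally_ramified_if_card:
  assumes "1 \<le> n" "card (new_points n) = q * p ^ n"
  shows "\<forall>m. ram m = q * geom m"
proof -
  obtain k where k: "n = Suc k"
    using assms(1) by (cases n) auto
  obtain j where j: "ram k = q * j"
    using ramification_dvd[OF quad_poly_red ram_pos red_ord_ram] by blast
  have "p * (q * j) \<le> q * j + q * p ^ n"
    using ram_Suc_ge[of k] ram_Suc[of k] assms(2) by (simp add: j k)
  hence "q * (p * j) \<le> q * (j + p ^ n)"
    by (simp add: algebra_simps)
  hence pj: "p * j \<le> j + p ^ n"
    using q_pos by simp
  have "geom k \<le> j"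
    using ram_ge[of k] q_pos by (simp add: j)
  moreover have "\<not> geom k < j"
  proof
    assume "geom k < j"
    then obtain i where i: "j = geom k + Suc i"
      using less_imp_Suc_add by fastforce
    have "p * geom k + 1 = geom k + p ^ n"
      using geom_Suc'[of k] by (simp add: k)
    moreover have "3 * Suc i \<le> p * Suc i"
      using p_ge_3 by (intro mult_le_mono) auto
    ultimately show False
      using pj by (simp add: i algebra_simps)
  qed
  ultimately have ram_k: "ram k = q * geom k"
    using j by simp
  hence "ram n = q * geom n"
    using ram_Suc[of k] assms(2) unfolding k geom_Suc' by (simp add: add_mult_distrib2)
  hence "ram 1 = q * geom 1" "ram 0 = q * geom 0"
    using ram_eq_downward assms(1) by blast+
  hence "ram 0 = q" "ram (Suc 0) = q * (p + 1)"
    by simp_all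
  thus ?thesis
    using minimally_ramified_from_first[OF quad_poly_red red_ord_ram ram_pos] by blast
qed

lemma card_if_minimally_ramified:
  assumes "\<forall>m. ram m = q * geom m" "1 \<le> n"
  shows "card (new_points n) = q * p ^ n"
proof -
  obtain k where k: "n = Suc k"
    using assms(2) by (cases n) auto
  show ?thesis
    using assms(1) ram_Suc[of k] unfolding k by (metis add_left_cancel add_mult_distrib2 geom_Suc')
qed

lemma optimal_if_card:
  assumes "1 \<le> n" "card (new_points n) = q * p ^ n" "z \<in> new_points n"
  shows "optimal_cycle_point av lam f p q n z"
proof -
  obtain k where k: "n = Suc k"
    using assms(1) by (cases n) auto
  have z: "av z < 1" "z \<noteq> 0"
    using assms(3) lower_points_subset(2)[of n] by (auto simp: new_points_def fix_points_def)
  have "av w = av z" if "w \<in> new_points n" for w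
  proof -
    have "w \<in> range (\<lambda>i. (f ^^ i) z)"
      using that orbit_eq_new_points[OF assms(2,3)] by (simp add: orbit_def)
    then obtain i where "w = (f ^^ i) z"
      by blast
    thus ?thesis
      using z av_funpow by simp
  qed
  hence "(\<Prod>x\<in>new_points n. av x) = av z ^ (q * p ^ n)"
    using assms(2) by simp
  hence eq: "av ((lam ^ (q * p ^ n) - 1) / (lam ^ (q * p ^ (n - 1)) - 1)) = av z ^ (q * p ^ n)"
    using prod_new_points[of n] by (simp add: k)
  have "0 < av z"
    using z(2) by (simp add: order.strict_iff_order)
  hence "av z = av ((lam ^ (q * p ^ n) - 1) / (lam ^ (q * p ^ (n - 1)) - 1)) powr (1 / real (q * p ^ n))"
    unfolding eq using qp_pos by (intro powr_inverse_power[symmetric])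
  thus ?thesis
    using z new_points_min_period[OF assms(3)] lam_power_neq_1[OF qp_pos]
    unfolding optimal_cycle_point_def by blast
qed

text \<open>The optimal absolute value makes the cycle of \<open>z\<close> alone account for the
  whole product; any further new point would contribute a factor below 1.\<close>

lemma card_if_optimal:
  assumes "1 \<le> n" "optimal_cycle_point av lam f p q n z"
  shows "card (new_points n) = q * p ^ n"
proof -
  obtain k where k: "n = Suc k"
    using assms(1) by (cases n) auto
  have z: "av z < 1" "min_period f z (q * p ^ n)"
    and opt: "av z = av ((lam ^ (q * p ^ n) - 1) / (lam ^ (q * p ^ (n - 1)) - 1)) powr (1 / real (q * p ^ n))"
    using assms(2) by (auto simp: optimal_cycle_point_def)
  have z_new: "z \<in> new_points n"
    by (rule min_period_new_points[OF z assms(1)])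
  define r where "r = av ((lam ^ (q * p ^ n) - 1) / (lam ^ (q * p ^ (n - 1)) - 1))"
  have "z \<noteq> 0"
    using z_new lower_points_subset(2)[of n] by (auto simp: new_points_def)
  hence "0 < av z"
    by (simp add: order.strict_iff_order)
  have "0 < r"
    using lam_power_neq_1[OF qp_pos] by (simp add: r_def order.strict_iff_order)
  have "av z ^ (q * p ^ n) = av z powr real (q * p ^ n)"
    using \<open>0 < av z\<close> by (rule powr_realpow[symmetric])
  also have "\<dots> = r"
    using opt \<open>0 < r\<close> q_pos p_ge_3 unfolding r_def [symmetric]
    by (simp add: powr_powr del: of_nat_mult of_nat_power)
  finally have r: "av z ^ (q * p ^ n) = r" .
  define S where "S = orbit f z"
  have S: "S \<subseteq> new_points n" "card S = q * p ^ n"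
    using orbit_subset_new_points[OF z_new] card_orbit(2)[OF z(2)] by (auto simp: S_def)
  have "(\<Prod>x\<in>S. av x) = (\<Prod>x\<in>S. av z)"
    using z(1) av_funpow by (intro prod.cong) (auto simp: S_def orbit_def)
  hence "(\<Prod>x\<in>S. av x) = r"
    by (simp add: S(2) r)
  moreover have "(\<Prod>x\<in>new_points n. av x) = r"
    using prod_new_points[of n] by (simp add: k r_def)
  ultimately have "(\<Prod>x\<in>new_points n - S. av x) * r = r"
    using prod.subset_diff[OF S(1) finite_new_points, of av] by simp
  hence prod: "(\<Prod>x\<in>new_points n - S. av x) = 1"
    using \<open>0 < r\<close> by simp
  have "new_points n - S = {}"
  proof (rule ccontr)
    assume "new_points n - S \<noteq> {}"
    hence "(\<Prod>x\<in>new_points n - S. av x) < 1"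
      using finite_new_points by (intro prod_less_1) (auto simp: new_points_def fix_points_def)
    thus False
      using prod by simp
  qed
  thus ?thesis
    using S by (metis Diff_eq_empty_iff subset_antisym)
qed

end

theorem theoremC:
  fixes av :: "'a::field \<Rightarrow> real" and lam :: 'a and p q :: nat
  assumes "prime p" and "odd p"
    and "ultrametric_abs av"
    and "alg_closed_field TYPE('a)"
    and "residue_char av p"
    and "av lam = 1"
    and "residue_order av lam q"
    and "lam ^ q \<noteq> 1"
    and "(\<forall>m::nat. 0 < m \<longrightarrow> of_nat m \<noteq> (0::'a)) \<longrightarrow>
           (\<forall>P :: int poly. P \<noteq> 0 \<longrightarrow> poly (map_poly of_int P) lam \<noteq> 0)"
  shows "(red_minimally_ramified av p q (quad_poly lam) \<longrightarrow>
            (\<forall>n::nat. 1 \<le> n \<longrightarrow>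
               (\<exists>z0. av z0 < 1 \<and> min_period (quad_map lam) z0 (q * p ^ n) \<and>
                  (\<forall>z. av z < 1 \<and> min_period (quad_map lam) z (q * p ^ n) \<longrightarrow>
                       z \<in> orbit (quad_map lam) z0)) \<and>
               (\<forall>z. av z < 1 \<and> min_period (quad_map lam) z (q * p ^ n) \<longrightarrow>
                    optimal_cycle_point av lam (quad_map lam) p q n z)))
       \<and> (\<not> red_minimally_ramified av p q (quad_poly lam) \<longrightarrow>
            (\<forall>n::nat. 1 \<le> n \<longrightarrow> \<not> has_optimal_cycle av lam (quad_map lam) p q n))"
proof -
  \<comment> \<open>The facts on the characteristic proved in this smaller locale are used to
    establish simplicity, which \<open>quadratic_dynamics\<close> assumes.\<close>
  interpret residue_multiplier av p lam q
    using assms by unfold_locales (auto simp: residue_char_def)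
  have lam: "lam \<noteq> 0"
    using \<open>av lam = 1\<close> by auto
  have generic: "0 \<notin> one_plus_ideal (inverse lam)"
  proof (cases "\<forall>m::nat. 0 < m \<longrightarrow> of_nat m \<noteq> (0::'a)")
    case True
    thus ?thesis
      using assms(9) lam by (intro zero_not_in_one_plus_ideal_transcendental) auto
  next
    case False
    hence "of_nat p = (0 :: 'a)"
      using char_p by blast
    thus ?thesis
      using lam p_ge_3 not_root_of_unity_char_p \<open>lam ^ q \<noteq> 1\<close>
      by (intro zero_not_in_one_plus_ideal_char_p[of _ p]) auto
  qed
  interpret quadratic_dynamics av p lam q
    using assms(4) quad_map_funpow_fixed_simple[OF lam generic] by unfold_locales auto
  show ?thesis
    unfolding red_minimally_ramified_iff
  proof (intro conjI impI allI)
    fix n :: nat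
    assume ram: "\<forall>n. ram n = q * geom n" and n: "1 \<le> n"
    have card: "card (new_points n) = q * p ^ n"
      by (rule card_if_minimally_ramified[OF ram n])
    obtain z0 where z0: "z0 \<in> new_points n"
      using new_points_nonempty by blast
    thus "\<exists>z0. av z0 < 1 \<and> min_period (quad_map lam) z0 (q * p ^ n) \<and>
        (\<forall>z. av z < 1 \<and> min_period (quad_map lam) z (q * p ^ n) \<longrightarrow> z \<in> orbit (quad_map lam) z0)"
      using new_points_min_period[OF z0] min_period_new_points[OF _ _ n] orbit_eq_new_points[OF card z0]
      by (intro exI[of _ z0]) (auto simp: new_points_def fix_points_def)
    show "optimal_cycle_point av lam (quad_map lam) p q n z"
      if "av z < 1 \<and> min_period (quad_map lam) z (q * p ^ n)" for z
      using optimal_if_card[OF n card] min_period_new_points[OF _ _ n] that by blast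
  next
    fix n :: nat
    assume "\<not> (\<forall>n. ram n = q * geom n)" "1 \<le> n"
    thus "\<not> has_optimal_cycle av lam (quad_map lam) p q n"
      using minimally_ramified_if_card card_if_optimal unfolding has_optimal_cycle_def by blast
  qed
qed

end
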